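(* Let $X\subset \mathbb R^n$ be open and let $F\subset J^2(X)$ be a constant-coefficient primitive subequation that depends only on the Hessian part. Suppose $f:X\times \mathbb R^m\to \mathbb R$ is locally semiconcave, bounded from below, and $F\#\mathcal P$-subharmonic on $X\times\mathbb R^m$. Then the marginal function $g(x) = \inf_{y\in\mathbb R^m} f(x,y)$ is $F$-subharmonic on $X$.
   Context: For open $X\subset\mathbb R^n$, the 2-jet bundle is $J^2(X)=X\times\mathbb R\times\mathbb R^n\times\operatorname{Sym}^2_n$, where $\operatorname{Sym}^2_n$ is the space of real symmetric $n\times n$ matrices; write $J^2_n=\mathbb R\times\mathbb R^n\times \operatorname{Sym}^2_n$, and for $F\subset J^2(X)$, $F_x=\{(r,p,A)\in J^2_n:(x,r,p,A)\in F\}$. $F$ is a primitive subequation if $F$ is closed and (positivity) $(r,p,A)\in F_x$ and $P$ positive semidefinite imply $(r,p,A+P)\in F_x$. $F$ is constant-coefficient if $F_x$ is independent of $x$; $F$ depends only on the Hessian part if for each $x$, $(r,p,A)\in F_x\iff(r',p',A)\in F_x$ for all $r,r',p,p',A$. For $f:X\to\mathbb R\cup\{-\infty\}$, a point $x$ with $f(x)\neq-\infty$ is an upper contact point with upper contact jet $(p,A)\in\mathbb R^n\times\operatorname{Sym}^2_n$ (also written $(f(x),p,A)$) if $f(y)\le f(x)+p\cdot(y-x)+\frac12(y-x)^tA(y-x)$ for all $y$ sufficiently near $x$. An upper-semicontinuous $f:X\to\mathbb R\cup\{-\infty\}$ is $F$-subharmonic if $(f(x),p,A)\in F_x$ for every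 upper contact jet $(p,A)$ of $f$ at every $x$. Let $\mathcal P\subset J^2(\mathbb R^m)$ be $\{(y,r,p,D): D \text{ positive semidefinite}\}$. For $\Gamma\in\operatorname{Hom}(\mathbb R^n,\mathbb R^m)$ (an $m\times n$ matrix) and $\alpha=(r,p,A)\in J^2_{n+m}$ with $p=(p_1,p_2)\in\mathbb R^n\times\mathbb R^m$ and $A=\begin{pmatrix}B&C\\C^t&D\end{pmatrix}$ in block form ($B\in\operatorname{Sym}^2_n$, $D\in\operatorname{Sym}^2_m$), set $i_\Gamma^*\alpha=(r,p_1+\Gamma^tp_2, B+C\Gamma+\Gamma^tC^t+\Gamma^tD\Gamma)\in J^2_n$ and $j^*\alpha=(r,p_2,D)\in J^2_m$. The product $F\#\mathcal P\subset J^2(X\times\mathbb R^m)$ is defined by $(F\#\mathcal P)_{(x,y)}=\{\alpha\in J^2_{n+m}: i_\Gamma^*\alpha\in F_x \text{ for all }\Gamma\in\operatorname{Hom}(\mathbb R^n,\mathbb R^m),\ j^*\alpha\in\mathcal P_y\}$. A function $h$ is $\kappa$-semiconcave ($\kappa\ge0$) if $h(z)-\frac\kappa2\|z\|^2$ is concave; locally semiconcave means every point has a neighbourhood on which $h$ is $\kappa$-semiconcave for some $\kappa\ge0$. *)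

theory Defs
  imports "HOL-Analysis.Analysis"
begin

definition sym_mat :: "real^'n^'n \<Rightarrow> bool" where
  "sym_mat A \<longleftrightarrow> transpose A = A"

definition psd_mat :: "real^'n^'n \<Rightarrow> bool" where
  "psd_mat A \<longleftrightarrow> sym_mat A \<and> (\<forall>v. 0 \<le> v \<bullet> (A *v v))"

definition J2 :: "(real^'n) set \<Rightarrow> ((real^'n) \<times> real \<times> (real^'n) \<times> (real^'n^'n)) set" where
  "J2 X = X \<times> UNIV \<times> UNIV \<times> {A. sym_mat A}"

definition primitive_subequation ::
  "(real^'n) set \<Rightarrow> ((real^'n) \<times> real \<times> (real^'n) \<times> (real^'n^'n)) set \<Rightarrow> bool" where
  "primitive_subequation X F \<longleftrightarrow>
     F \<subseteq> J2 X \<and> closedin (top_of_set (J2 X)) F \<and>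
     (\<forall>x r p A P. (x, r, p, A) \<in> F \<longrightarrow> psd_mat P \<longrightarrow> (x, r, p, A + P) \<in> F)"

definition constant_coefficient ::
  "(real^'n) set \<Rightarrow> ((real^'n) \<times> real \<times> (real^'n) \<times> (real^'n^'n)) set \<Rightarrow> bool" where
  "constant_coefficient X F \<longleftrightarrow>
     (\<forall>x\<in>X. \<forall>x'\<in>X. \<forall>r p A. (x, r, p, A) \<in> F \<longleftrightarrow> (x', r, p, A) \<in> F)"

definition hessian_only ::
  "(real^'n) set \<Rightarrow> ((real^'n) \<times> real \<times> (real^'n) \<times> (real^'n^'n)) set \<Rightarrow> bool" where
  "hessian_only X F \<longleftrightarrow>
     (\<forall>x\<in>X. \<forall>r r' p p' A. (x, r, p, A) \<in> F \<longleftrightarrow> (x, r', p', A) \<in> F)"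

definition usc_on :: "'a::topological_space set \<Rightarrow> ('a \<Rightarrow> real) \<Rightarrow> bool" where
  "usc_on S u \<longleftrightarrow> (\<forall>x\<in>S. \<forall>e>0. \<forall>\<^sub>F y in at x within S. u y < u x + e)"

definition upper_contact :: "(real^'n \<Rightarrow> real) \<Rightarrow> real^'n \<Rightarrow> real^'n \<Rightarrow> real^'n^'n \<Rightarrow> bool" where
  "upper_contact u x p A \<longleftrightarrow>
     (\<exists>d>0. \<forall>y\<in>ball x d. u y \<le> u x + p \<bullet> (y - x) + (1/2) * ((y - x) \<bullet> (A *v (y - x))))"

definition F_subharmonic ::
  "(real^'n) set \<Rightarrow> ((real^'n) \<times> real \<times> (real^'n) \<times> (real^'n^'n)) set \<Rightarrow> (real^'n \<Rightarrow> real) \<Rightarrow> bool" where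
  "F_subharmonic X F u \<longleftrightarrow> usc_on X u \<and>
     (\<forall>x\<in>X. \<forall>p A. sym_mat A \<longrightarrow> upper_contact u x p A \<longrightarrow> (x, u x, p, A) \<in> F)"

text \<open>Jets on X x R^m written in block form: gradient (p1,p2), Hessian [[B,C],[C^t,D]]
  with B :: n x n, C :: n x m, D :: m x m.\<close>
definition upper_contact_prod ::
  "((real^'n) \<times> (real^'m) \<Rightarrow> real) \<Rightarrow> real^'n \<Rightarrow> real^'m \<Rightarrow> real^'n \<Rightarrow> real^'m
     \<Rightarrow> real^'n^'n \<Rightarrow> real^'m^'n \<Rightarrow> real^'m^'m \<Rightarrow> bool" where
  "upper_contact_prod u x y p1 p2 B C D \<longleftrightarrow>
     (\<exists>d>0. \<forall>z w. (z, w) \<in> ball (x, y) d \<longrightarrow>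
        u (z, w) \<le> u (x, y) + p1 \<bullet> (z - x) + p2 \<bullet> (w - y)
          + (1/2) * ((z - x) \<bullet> (B *v (z - x)) + 2 * ((z - x) \<bullet> (C *v (w - y)))
                     + (w - y) \<bullet> (D *v (w - y))))"

text \<open>Membership in the fibre (F # P)_(x,y): i_Gamma^* alpha in F_x for all Gamma, and j^* alpha in P_y.\<close>
definition in_sharp_P ::
  "((real^'n) \<times> real \<times> (real^'n) \<times> (real^'n^'n)) set \<Rightarrow> real^'n \<Rightarrow> real \<Rightarrow> real^'n \<Rightarrow> real^'m
     \<Rightarrow> real^'n^'n \<Rightarrow> real^'m^'n \<Rightarrow> real^'m^'m \<Rightarrow> bool" where
  "in_sharp_P F x r p1 p2 B C D \<longleftrightarrow>
     (\<forall>\<Gamma> :: real^'n^'m.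
        (x, r, p1 + transpose \<Gamma> *v p2,
         B + C ** \<Gamma> + transpose \<Gamma> ** transpose C + transpose \<Gamma> ** D ** \<Gamma>) \<in> F)
     \<and> psd_mat D"

definition sharp_P_subharmonic ::
  "(real^'n) set \<Rightarrow> ((real^'n) \<times> real \<times> (real^'n) \<times> (real^'n^'n)) set
     \<Rightarrow> ((real^'n) \<times> (real^'m) \<Rightarrow> real) \<Rightarrow> bool" where
  "sharp_P_subharmonic X F u \<longleftrightarrow> usc_on (X \<times> UNIV) u \<and>
     (\<forall>x\<in>X. \<forall>y p1 p2 B C D. sym_mat B \<longrightarrow> sym_mat D \<longrightarrow>
        upper_contact_prod u x y p1 p2 B C D \<longrightarrow> in_sharp_P F x (u (x, y)) p1 p2 B C D)"

definition semiconcave_on :: "real \<Rightarrow> 'a::real_normed_vector set \<Rightarrow> ('a \<Rightarrow> real) \<Rightarrow> bool" where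
  "semiconcave_on \<kappa> S h \<longleftrightarrow> 0 \<le> \<kappa> \<and> concave_on S (\<lambda>z. h z - (\<kappa> / 2) * (norm z)\<^sup>2)"

definition locally_semiconcave_on :: "'a::real_normed_vector set \<Rightarrow> ('a \<Rightarrow> real) \<Rightarrow> bool" where
  "locally_semiconcave_on S h \<longleftrightarrow>
     (\<forall>z\<in>S. \<exists>r>0. \<exists>\<kappa>. ball z r \<subseteq> S \<and> semiconcave_on \<kappa> (ball z r) h)"

end

theory Submission
  imports Defs
begin

text \<open>If a jet with Hessian \<open>A\<close> violated the claim at \<open>x\<^sub>0\<close>, then \<open>A' = A + \<epsilon> I\<close> still lies
  outside \<open>F\<close>; after subtracting the quadratic \<open>q\<close> with Hessian \<open>A'\<close>, the marginal of \<open>f - q\<close> has a strict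
  peak at \<open>x\<^sub>0\<close>.  It suffices to find, near \<open>x\<^sub>0\<close>, a point where \<open>f - q\<close> is touched from above by an affine
  function plus \<open>K |y - \<Gamma> x|\<^sup>2\<close> with \<open>\<Gamma>\<close> linear: the restriction to the graph of \<open>\<Gamma>\<close> of the resulting jet of
  \<open>f\<close> is exactly \<open>A'\<close>.

  Adding \<open>\<sigma> |y|\<^sup>2\<close> and taking a sup-convolution in \<open>x\<close> only (which preserves upper contact jets) yields \<open>h\<close>
  that is semiconcave, semiconvex, and strongly convex in \<open>y\<close>.  Its argmin \<open>\<gamma>\<close> is then Lipschitz, its marginal
  \<open>G\<close> still peaks, and \<open>h (x, y) \<le> G x + C |y - \<gamma> x|\<^sup>2\<close>.  The set of points where \<open>G\<close> is touched from
  above by a strictly concave paraboloid has positive measure, so one of these points is also a point where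
  \<open>\<gamma>\<close> is close to a linear \<open>\<Gamma>\<close> on some small scale; a small perturbation gives the required contact.

  Full differentiability of \<open>\<gamma>\<close> is not needed.  Closeness to linear maps along a sequence of scales holds
  almost everywhere by an energy argument: with \<open>E e\<close> the integral of \<open>|u (x + e) - u x|\<^sup>2\<close>, the parallelogram
  law gives \<open>4 E e = E (2 e) + J e\<close>, where \<open>J\<close> is the integral of the squared second difference, so the scaled
  second differences along \<open>2\<^sup>-\<^sup>k e\<close> are square summable almost everywhere.\<close>

section \<open>Lipschitz maps are approximately linear almost everywhere\<close>

lemma nn_integral_lborel_shift:
  fixes f :: "'a::euclidean_space \<Rightarrow> ennreal"
  assumes "f \<in> borel_measurable borel"
  shows "(\<integral>\<^sup>+x. f (x + c) \<partial>lborel) = (\<integral>\<^sup>+x. f x \<partial>lborel)"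
proof -
  have "(\<integral>\<^sup>+x. f x \<partial>lborel) = (\<integral>\<^sup>+x. f x \<partial>(distr lborel borel ((+) c)))"
    by (simp add: lborel_distr_plus)
  also have "\<dots> = (\<integral>\<^sup>+x. f (c + x) \<partial>lborel)"
    using assms by (subst nn_integral_distr) auto
  finally show ?thesis by (simp add: add.commute)
qed

text \<open>Uncentred form: the increment from \<open>x + e\<close> to
  \<open>x + 2 *\<^sub>R e\<close> minus the increment from \<open>x\<close> to
  \<open>x + e\<close>, so that the parallelogram law applies to these two increments.\<close>

abbreviation second_diff :: "('a::real_vector \<Rightarrow> 'b::real_vector) \<Rightarrow> 'a \<Rightarrow> 'a \<Rightarrow> 'b" where
  "second_diff u e x \<equiv> u (x + 2 *\<^sub>R e) - 2 *\<^sub>R u (x + e) + u x"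

text \<open>Parallelogram law for two consecutive increments of \<open>u\<close>: their sum is the
  increment over \<open>2 *\<^sub>R e\<close>, their difference the second difference. By
  translation invariance both have the same energy, hence the factor 4. Working in
  \<open>ennreal\<close> postpones all questions of finiteness.\<close>

lemma difference_energy_step:
  fixes u :: "'a::euclidean_space \<Rightarrow> 'b::euclidean_space"
  assumes "continuous_on UNIV u"
  shows "4 * (\<integral>\<^sup>+x. ennreal ((norm (u (x + e) - u x))\<^sup>2) \<partial>lborel)
       = (\<integral>\<^sup>+x. ennreal ((norm (u (x + 2 *\<^sub>R e) - u x))\<^sup>2) \<partial>lborel)
       + (\<integral>\<^sup>+x. ennreal ((norm (second_diff u e x))\<^sup>2) \<partial>lborel)"
proof -
  have [measurable]: "u \<in> borel_measurable borel"
    using assms by (rule borel_measurable_continuous_onI)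
  have meas: "(\<lambda>x. ennreal ((norm (u (x + e) - u x))\<^sup>2)) \<in> borel_measurable borel"
    by measurable
  have shift: "(\<integral>\<^sup>+x. ennreal ((norm (u (x + 2 *\<^sub>R e) - u (x + e)))\<^sup>2) \<partial>lborel)
      = (\<integral>\<^sup>+x. ennreal ((norm (u (x + e) - u x))\<^sup>2) \<partial>lborel)"
    using nn_integral_lborel_shift[OF meas, of e] by (simp add: scaleR_2 add.assoc)
  have par: "2 * ((norm (u (x + e) - u x))\<^sup>2 + (norm (u (x + 2 *\<^sub>R e) - u (x + e)))\<^sup>2)
      = (norm (u (x + 2 *\<^sub>R e) - u x))\<^sup>2 + (norm (second_diff u e x))\<^sup>2" for x
    by (simp add: power2_norm_eq_inner inner_simps scaleR_2 inner_commute algebra_simps)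
  have "(\<integral>\<^sup>+x. ennreal ((norm (u (x + 2 *\<^sub>R e) - u x))\<^sup>2) \<partial>lborel)
       + (\<integral>\<^sup>+x. ennreal ((norm (second_diff u e x))\<^sup>2) \<partial>lborel)
     = (\<integral>\<^sup>+x. ennreal ((norm (u (x + 2 *\<^sub>R e) - u x))\<^sup>2) 
             + ennreal ((norm (second_diff u e x))\<^sup>2) \<partial>lborel)"
    by (subst nn_integral_add) auto
  also have "\<dots> = (\<integral>\<^sup>+x. 2 * (ennreal ((norm (u (x + e) - u x))\<^sup>2)
        + ennreal ((norm (u (x + 2 *\<^sub>R e) - u (x + e)))\<^sup>2)) \<partial>lborel)"
    unfolding ennreal_plus[symmetric, OF zero_le_power2 zero_le_power2] par[symmetric]
    by (subst ennreal_mult) auto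
  also have "\<dots> = 2 * ((\<integral>\<^sup>+x. ennreal ((norm (u (x + e) - u x))\<^sup>2) \<partial>lborel)
        + (\<integral>\<^sup>+x. ennreal ((norm (u (x + 2 *\<^sub>R e) - u (x + e)))\<^sup>2) \<partial>lborel))"
    by (subst nn_integral_cmult, measurable, subst nn_integral_add) auto
  also have "\<dots> = 4 * (\<integral>\<^sup>+x. ennreal ((norm (u (x + e) - u x))\<^sup>2) \<partial>lborel)"
    unfolding shift by (simp add: mult_2[symmetric] mult.assoc[symmetric])
  finally show ?thesis ..
qed

text \<open>The radius uses \<open>M\<close> rather than \<open>norm e\<close>, so that one ball
  serves all halvings of \<open>e\<close> and the bound is quadratic in \<open>norm e\<close> with a
  fixed constant.\<close>

lemma difference_energy_bound:
  fixes u :: "'a::euclidean_space \<Rightarrow> 'b::euclidean_space"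
  assumes lip: "L-lipschitz_on UNIV u" and supp: "\<And>x. R < norm x \<Longrightarrow> u x = 0"
    and e: "norm e \<le> M"
  shows "(\<integral>\<^sup>+x. ennreal ((norm (u (x + e) - u x))\<^sup>2) \<partial>lborel)
    \<le> ennreal ((L * norm e)\<^sup>2) * emeasure lborel (cball (0::'a) (R + M))"
proof -
  have "(\<integral>\<^sup>+x. ennreal ((norm (u (x + e) - u x))\<^sup>2) \<partial>lborel)
     \<le> (\<integral>\<^sup>+x. ennreal ((L * norm e)\<^sup>2) * indicator (cball (0::'a) (R + M)) x \<partial>lborel)"
  proof (rule nn_integral_mono)
    fix x
    show "ennreal ((norm (u (x + e) - u x))\<^sup>2)
        \<le> ennreal ((L * norm e)\<^sup>2) * indicator (cball (0::'a) (R + M)) x"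
    proof (cases "x \<in> cball 0 (R + M)")
      case True
      have "norm (u (x + e) - u x) \<le> L * norm e"
        using lipschitz_on_normD[OF lip, of "x + e" x] by simp
      with True show ?thesis by (simp add: ennreal_leI power_mono)
    next
      case False
      then have "R + M < norm x" by simp
      moreover have "norm x - norm e \<le> norm (x + e)"
        by (rule norm_diff_ineq)
      moreover have "0 \<le> M" using e norm_ge_zero order_trans by blast
      ultimately have "u x = 0" "u (x + e) = 0" using e by (auto intro!: supp)
      then show ?thesis by simp
    qed
  qed
  also have "\<dots> = ennreal ((L * norm e)\<^sup>2) * emeasure lborel (cball (0::'a) (R + M))"
    by (rule nn_integral_cmult_indicator) auto
  finally show ?thesis .
qed

text \<open>Weighted by powers of 4, the energy identities telescope to
  \<open>I 0 + (\<Sum>k<n. 4 ^ k * J (Suc k)) = 4 ^ n * I n\<close>, and the Lipschitz bound keeps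
  the right-hand side below \<open>C\<close>. Hence the series of scaled squared second differences
  has a finite integral, converges almost everywhere, and its terms vanish. The offset
  \<open>c\<close> does not change the integrals; it gives access to all base points of the blow-up
  at \<open>x\<close>.\<close>

lemma AE_second_diff_tendsto_0:
  fixes u :: "'a::euclidean_space \<Rightarrow> 'b::euclidean_space"
  assumes lip: "L-lipschitz_on UNIV u" and supp: "\<And>x. R < norm x \<Longrightarrow> u x = 0"
  shows "AE x in lborel.
    (\<lambda>k. 2 ^ k *\<^sub>R second_diff u ((1/2) ^ k *\<^sub>R e) (x + (1/2) ^ k *\<^sub>R c)) \<longlonglongrightarrow> 0"
proof -
  have cont: "continuous_on UNIV u" using lip by (rule lipschitz_on_continuous_on)
  have [measurable]: "u \<in> borel_measurable borel"
    using cont by (rule borel_measurable_continuous_onI)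
  define I where "I k = (\<integral>\<^sup>+x. ennreal ((norm (u (x + (1/2) ^ k *\<^sub>R e) - u x))\<^sup>2) \<partial>lborel)" for k
  define J where "J k = (\<integral>\<^sup>+x. ennreal ((norm (second_diff u ((1/2) ^ k *\<^sub>R e) x))\<^sup>2) \<partial>lborel)" for k
  define C where "C = ennreal ((L * norm e)\<^sup>2) * emeasure lborel (cball (0::'a) (R + norm e))"
  have step: "4 * I (Suc k) = I k + J (Suc k)" for k
    using difference_energy_step[OF cont, of "(1/2) ^ Suc k *\<^sub>R e"] by (simp add: I_def J_def)
  have bound: "4 ^ k * I k \<le> C" for k
  proof -
    have "norm ((1/2) ^ k *\<^sub>R e) \<le> norm e" by (simp add: mult_left_le_one_le power_le_one)
    then have "I k \<le> ennreal ((L * norm ((1/2) ^ k *\<^sub>R e))\<^sup>2) * emeasure lborel (cball (0::'a) (R + norm e))"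
      unfolding I_def using difference_energy_bound[OF lip, of R] supp by blast
    then have "4 ^ k * I k \<le> 4 ^ k * (ennreal ((L * norm ((1/2) ^ k *\<^sub>R e))\<^sup>2) * emeasure lborel (cball (0::'a) (R + norm e)))"
      by (intro mult_left_mono) auto
    also have "\<dots> = (ennreal (4 ^ k) * ennreal ((L * norm ((1/2) ^ k *\<^sub>R e))\<^sup>2)) * emeasure lborel (cball (0::'a) (R + norm e))"
      by (simp add: mult.assoc ennreal_power[symmetric])
    also have "ennreal (4 ^ k) * ennreal ((L * norm ((1/2) ^ k *\<^sub>R e))\<^sup>2) = ennreal ((L * norm e)\<^sup>2)"
    proof -
      have four: "(4::real) ^ k = (2 ^ k)\<^sup>2"
        by (simp add: power_mult[symmetric] mult.commute[of k] power_mult)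
      have "4 ^ k * (L * norm ((1/2) ^ k *\<^sub>R e))\<^sup>2 = (2 ^ k * (L * ((1/2) ^ k * norm e)))\<^sup>2"
        by (simp add: four power_mult_distrib)
      also have "2 ^ k * (L * ((1/2) ^ k * norm e)) = L * norm e"
        by (simp add: power_divide)
      finally show ?thesis by (subst ennreal_mult[symmetric]) auto
    qed
    finally show ?thesis by (simp add: C_def)
  qed
  have partial: "I 0 + (\<Sum>k<n. 4 ^ k * J (Suc k)) = 4 ^ n * I n" for n
  proof (induction n)
    case (Suc n)
    have "I 0 + (\<Sum>k<Suc n. 4 ^ k * J (Suc k)) = 4 ^ n * I n + 4 ^ n * J (Suc n)"
      using Suc by (simp add: add.assoc[symmetric])
    also have "\<dots> = 4 ^ n * (4 * I (Suc n))" unfolding step by (simp add: distrib_left)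
    finally show ?case by (simp add: mult_ac)
  qed simp
  have "(\<Sum>k<n. 4 ^ k * J (Suc k)) \<le> C" for n
  proof -
    have "(\<Sum>k<n. 4 ^ k * J (Suc k)) \<le> I 0 + (\<Sum>k<n. 4 ^ k * J (Suc k))"
      by (intro add_increasing) auto
    also have "\<dots> \<le> C" unfolding partial by (rule bound)
    finally show ?thesis .
  qed
  then have sumle: "(\<Sum>k. 4 ^ k * J (Suc k)) \<le> C"
    by (intro suminf_le_const) auto
  have C: "C < top"
    unfolding C_def using emeasure_bounded_finite[OF bounded_cball, of "0::'a" "R + norm e"]
    by (simp add: ennreal_mult_less_top)
  \<comment> \<open>The weight \<open>4 ^ k\<close> goes with scale \<open>Suc k\<close>, as in
    \<open>partial\<close>; the factor 2 in front of \<open>sqrt\<close> below turns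
    \<open>2 ^ k\<close> into the matching \<open>2 ^ Suc k\<close>.\<close>
  define g where "g k x = ennreal (4 ^ k * (norm (second_diff u ((1/2) ^ Suc k *\<^sub>R e) (x + (1/2) ^ Suc k *\<^sub>R c)))\<^sup>2)" for k x
  have [measurable]: "g k \<in> borel_measurable borel" for k
    unfolding g_def by measurable
  have int: "(\<integral>\<^sup>+x. g k x \<partial>lborel) = 4 ^ k * J (Suc k)" for k
  proof -
    have "(\<integral>\<^sup>+x. g k x \<partial>lborel) 
      = (\<integral>\<^sup>+x. 4 ^ k * ennreal ((norm (second_diff u ((1/2) ^ Suc k *\<^sub>R e) (x + (1/2) ^ Suc k *\<^sub>R c)))\<^sup>2) \<partial>lborel)"
      unfolding g_def by (intro nn_integral_cong) (simp add: ennreal_mult ennreal_power[symmetric])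
    also have "\<dots> = 4 ^ k * (\<integral>\<^sup>+x. ennreal ((norm (second_diff u ((1/2) ^ Suc k *\<^sub>R e) (x + (1/2) ^ Suc k *\<^sub>R c)))\<^sup>2) \<partial>lborel)"
      by (rule nn_integral_cmult) measurable
    also have "(\<integral>\<^sup>+x. ennreal ((norm (second_diff u ((1/2) ^ Suc k *\<^sub>R e) (x + (1/2) ^ Suc k *\<^sub>R c)))\<^sup>2) \<partial>lborel) = J (Suc k)"
      unfolding J_def
      by (rule nn_integral_lborel_shift[where f = "\<lambda>x. ennreal ((norm (second_diff u ((1/2) ^ Suc k *\<^sub>R e) x))\<^sup>2)"]) measurable
    finally show ?thesis .
  qed
  have "(\<integral>\<^sup>+x. (\<Sum>k. g k x) \<partial>lborel) = (\<Sum>k. 4 ^ k * J (Suc k))"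
    by (subst nn_integral_suminf) (auto simp: int)
  also have "\<dots> < top" using sumle C by (rule le_less_trans)
  finally have "AE x in lborel. (\<Sum>k. g k x) \<noteq> top"
    using nn_integral_noteq_infinite[of "\<lambda>x. \<Sum>k. g k x" lborel] by simp
  then show ?thesis
  proof eventually_elim
    fix x assume "(\<Sum>k. g k x) \<noteq> top"
    then have "summable (\<lambda>k. 4 ^ k * (norm (second_diff u ((1/2) ^ Suc k *\<^sub>R e) (x + (1/2) ^ Suc k *\<^sub>R c)))\<^sup>2)"
      unfolding g_def by (rule summable_suminf_not_top[rotated]) (intro mult_nonneg_nonneg zero_le_power2, simp)
    then have "(\<lambda>k. 4 ^ k * (norm (second_diff u ((1/2) ^ Suc k *\<^sub>R e) (x + (1/2) ^ Suc k *\<^sub>R c)))\<^sup>2) \<longlonglongrightarrow> 0"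
      by (rule summable_LIMSEQ_zero)
    then have "(\<lambda>k. 2 * sqrt (4 ^ k * (norm (second_diff u ((1/2) ^ Suc k *\<^sub>R e) (x + (1/2) ^ Suc k *\<^sub>R c)))\<^sup>2)) \<longlonglongrightarrow> 2 * sqrt 0"
      by (intro tendsto_intros)
    moreover have "2 * sqrt (4 ^ k * a\<^sup>2) = 2 ^ Suc k * a" if "0 \<le> a" for a :: real and k
    proof -
      have "(4::real) ^ k = (2 ^ k)\<^sup>2"
        by (simp add: power_mult[symmetric] mult.commute[of k] power_mult)
      then have "(4::real) ^ k * a\<^sup>2 = (2 ^ k * a)\<^sup>2"
        by (simp add: power_mult_distrib)
      then show ?thesis using that by (simp add: real_sqrt_unique)
    qed
    ultimately have "(\<lambda>k. norm (2 ^ Suc k *\<^sub>R second_diff u ((1/2) ^ Suc k *\<^sub>R e) (x + (1/2) ^ Suc k *\<^sub>R c))) \<longlonglongrightarrow> 0"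
      by (simp del: power_Suc)
    then have "(\<lambda>k. 2 ^ Suc k *\<^sub>R second_diff u ((1/2) ^ Suc k *\<^sub>R e) (x + (1/2) ^ Suc k *\<^sub>R c)) \<longlonglongrightarrow> 0"
      by (rule tendsto_norm_zero_cancel)
    then show "(\<lambda>k. 2 ^ k *\<^sub>R second_diff u ((1/2) ^ k *\<^sub>R e) (x + (1/2) ^ k *\<^sub>R c)) \<longlonglongrightarrow> 0"
      by (rule LIMSEQ_imp_Suc)
  qed
qed

section \<open>From vanishing second differences to nearby linear maps\<close>

text \<open>Cauchy's functional equation in the limit: induction gives natural multiples,
  cancellation the negative ones, division the rational ones; density and the common Lipschitz
  constant give the real ones.\<close>

lemma asymptotically_additive_imp_homogeneous:
  fixes v :: "nat \<Rightarrow> 'a::real_normed_vector \<Rightarrow> 'b::real_normed_vector"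
  assumes lip: "\<And>k. L-lipschitz_on UNIV (v k)"
    and add: "\<And>a b. (\<lambda>k. v k (a + b) - v k a - v k b) \<longlonglongrightarrow> 0"
  shows "(\<lambda>k. v k (r *\<^sub>R z) - r *\<^sub>R v k z) \<longlonglongrightarrow> 0"
proof -
  have zero: "(\<lambda>k. v k 0) \<longlonglongrightarrow> 0"
    using tendsto_minus[OF add[of 0 0]] by simp
  have nat: "(\<lambda>k. v k (real n *\<^sub>R z) - real n *\<^sub>R v k z) \<longlonglongrightarrow> 0" for n z
  proof (induction n)
    case 0
    then show ?case using zero by simp
  next
    case (Suc n)
    from tendsto_add[OF Suc add[of "real n *\<^sub>R z" z]] show ?case
      by (simp add: algebra_simps)
  qed
  have int: "(\<lambda>k. v k (of_int i *\<^sub>R z) - of_int i *\<^sub>R v k z) \<longlonglongrightarrow> 0" for i :: int and z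
  proof (cases "0 \<le> i")
    case True
    then show ?thesis using nat[of "nat i" z] by simp
  next
    case False
    define n where "n = nat (- i)"
    have i: "of_int i = - real n" using False by (simp add: n_def)
    have "(\<lambda>k. v k 0 - (v k (real n *\<^sub>R z + - (real n *\<^sub>R z)) - v k (real n *\<^sub>R z) - v k (- (real n *\<^sub>R z)))
        - (v k (real n *\<^sub>R z) - real n *\<^sub>R v k z)) \<longlonglongrightarrow> 0 - 0 - 0"
      by (intro tendsto_diff zero add nat)
    then show ?thesis by (simp add: i)
  qed
  have rat: "(\<lambda>k. v k (q *\<^sub>R z) - q *\<^sub>R v k z) \<longlonglongrightarrow> 0" if q: "q \<in> \<rat>" for q
  proof -
    obtain m n where n: "0 < n" and q: "q = of_int m / of_int n"
      using q by (metis Rats_cases')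
    have "(\<lambda>k. (1 / of_int n) *\<^sub>R ((v k (of_int m *\<^sub>R z) - of_int m *\<^sub>R v k z)
        - (v k (of_int n *\<^sub>R (q *\<^sub>R z)) - of_int n *\<^sub>R v k (q *\<^sub>R z)))) \<longlonglongrightarrow> (1 / of_int n) *\<^sub>R (0 - 0)"
      by (intro tendsto_intros int)
    moreover have "of_int n *\<^sub>R (q *\<^sub>R z) = of_int m *\<^sub>R z"
      using n by (simp add: q)
    ultimately show ?thesis
      using n by (simp add: scaleR_diff_right q)
  qed
  show ?thesis
  proof (rule tendstoI)
    fix e :: real assume e: "0 < e"
    have L: "0 \<le> L" using lip lipschitz_on_nonneg by blast
    \<comment> \<open>\<open>D\<close> adds the two costs of replacing \<open>r\<close> by a
      rational within \<open>d\<close>: \<open>d * (L * norm z)\<close> in the argument and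
      \<open>d * (L * norm z + 1)\<close> in the factor, since
      \<open>norm (v k z) \<le> L * norm z + 1\<close> once \<open>norm (v k 0) < 1\<close>.\<close>
    define D where "D = 2 * L * norm z + 1"
    define d where "d = e / (2 * D)"
    have D: "0 < D" unfolding D_def using L by (intro add_nonneg_pos) auto
    have d: "0 < d" "d * D = e / 2" using e D by (auto simp: d_def)
    obtain q where q: "q \<in> \<rat>" "r < q" "q < r + d"
      using Rats_dense_in_real[of r "r + d"] d by auto
    have ev0: "eventually (\<lambda>k. norm (v k 0) < 1) sequentially"
      using tendstoD[OF zero, of 1] by (simp add: dist_norm)
    have ev1: "eventually (\<lambda>k. norm (v k (q *\<^sub>R z) - q *\<^sub>R v k z) < e / 2) sequentially"
      using tendstoD[OF rat[OF q(1)], of "e/2"] e by (simp add: dist_norm)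
    from ev0 ev1 show "eventually (\<lambda>k. dist (v k (r *\<^sub>R z) - r *\<^sub>R v k z) 0 < e) sequentially"
    proof eventually_elim
      fix k assume k0: "norm (v k 0) < 1" and k1: "norm (v k (q *\<^sub>R z) - q *\<^sub>R v k z) < e / 2"
      have a: "norm (v k (r *\<^sub>R z) - v k (q *\<^sub>R z)) \<le> L * (d * norm z)"
      proof -
        have "norm (v k (r *\<^sub>R z) - v k (q *\<^sub>R z)) \<le> L * norm (r *\<^sub>R z - q *\<^sub>R z)"
          using lipschitz_on_normD[OF lip] by blast
        also have "norm (r *\<^sub>R z - q *\<^sub>R z) = \<bar>r - q\<bar> * norm z"
          by (simp flip: scaleR_diff_left)
        also have "L * (\<bar>r - q\<bar> * norm z) \<le> L * (d * norm z)"
          using q L by (intro mult_left_mono mult_right_mono) auto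
        finally show ?thesis .
      qed
      have b: "norm ((q - r) *\<^sub>R v k z) \<le> d * (L * norm z + 1)"
      proof -
        have "norm (v k z - v k 0) \<le> L * norm z"
          using lipschitz_on_normD[OF lip, of z 0] by simp
        then have "norm (v k z) \<le> L * norm z + 1"
          using k0 norm_triangle_ineq2[of "v k z" "v k 0"] by linarith
        then show ?thesis using q by (simp add: mult_mono)
      qed
      have "norm (v k (r *\<^sub>R z) - r *\<^sub>R v k z)
          = norm ((v k (r *\<^sub>R z) - v k (q *\<^sub>R z)) + (v k (q *\<^sub>R z) - q *\<^sub>R v k z) + (q - r) *\<^sub>R v k z)"
        by (simp add: algebra_simps)
      also have "\<dots> \<le> L * (d * norm z) + norm (v k (q *\<^sub>R z) - q *\<^sub>R v k z) + d * (L * norm z + 1)"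
        by (intro norm_triangle_mono a b order_refl)
      also have "\<dots> < e / 2 + d * D"
        using k1 by (simp add: D_def algebra_simps)
      finally show "dist (v k (r *\<^sub>R z) - r *\<^sub>R v k z) 0 < e"
        using d by (simp add: dist_norm algebra_simps)
    qed
  qed
qed


text \<open>The candidate for index \<open>k\<close> is the linear map that agrees with
  \<open>v k\<close> on the basis, so the maps need not converge. Additivity and homogeneity in the
  limit give pointwise closeness; a finite net of the unit ball and a common Lipschitz constant make
  it uniform.\<close>

lemma additive_null_imp_eventually_linear:
  fixes v :: "nat \<Rightarrow> 'a::euclidean_space \<Rightarrow> 'b::real_normed_vector"
  assumes lip: "\<And>k. L-lipschitz_on UNIV (v k)"
    and add: "\<And>a b. (\<lambda>k. v k (a + b) - v k a - v k b) \<longlonglongrightarrow> 0"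
    and \<delta>: "0 < \<delta>"
  shows "eventually (\<lambda>k. \<exists>\<Gamma>. linear \<Gamma> \<and> (\<forall>z\<in>cball 0 1. norm (v k z - \<Gamma> z) \<le> \<delta>)) sequentially"
proof -
  define \<Gamma> where "\<Gamma> k z = (\<Sum>b\<in>Basis. (z \<bullet> b) *\<^sub>R v k b)" for k z
  have lin: "linear (\<Gamma> k)" for k
    unfolding \<Gamma>_def by (intro linear_compose_sum ballI) (auto intro!: linearI simp: inner_simps scaleR_add_left)
  have L: "0 \<le> L" using lip lipschitz_on_nonneg by blast
  have zero: "(\<lambda>k. v k 0) \<longlonglongrightarrow> 0"
    using tendsto_minus[OF add[of 0 0]] by simp
  have sum: "(\<lambda>k. v k (\<Sum>b\<in>S. c b *\<^sub>R b) - (\<Sum>b\<in>S. c b *\<^sub>R v k b)) \<longlonglongrightarrow> 0"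
    if "finite S" for S :: "'a set" and c
    using that
  proof induction
    case empty
    then show ?case using zero by simp
  next
    case (insert b S)
    have "(\<lambda>k. (v k (c b *\<^sub>R b + (\<Sum>b\<in>S. c b *\<^sub>R b)) - v k (c b *\<^sub>R b) - v k (\<Sum>b\<in>S. c b *\<^sub>R b))
        + (v k (c b *\<^sub>R b) - c b *\<^sub>R v k b)
        + (v k (\<Sum>b\<in>S. c b *\<^sub>R b) - (\<Sum>b\<in>S. c b *\<^sub>R v k b))) \<longlonglongrightarrow> 0 + 0 + 0"
      by (intro tendsto_add add insert.IH asymptotically_additive_imp_homogeneous[OF lip add])
    then show ?case using insert by (simp add: algebra_simps)
  qed
  have null: "(\<lambda>k. v k z - \<Gamma> k z) \<longlonglongrightarrow> 0" for z
    using sum[OF finite_Basis, of "\<lambda>b. z \<bullet> b"] by (simp add: \<Gamma>_def euclidean_representation)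
  \<comment> \<open>\<open>M\<close> is a Lipschitz constant of \<open>v k - \<Gamma> k\<close>:
    \<open>L\<close> from \<open>v k\<close>, and the rest from \<open>\<Gamma> k\<close>, whose
    basis values are bounded by \<open>L + 1\<close> once \<open>norm (v k 0) < 1\<close>.\<close>
  define M where "M = L + real DIM('a) * (L + 1)"
  have M: "0 < M" unfolding M_def using L by (intro add_nonneg_pos mult_pos_pos) auto
  define \<eta> where "\<eta> = \<delta> / (2 * M)"
  have \<eta>: "0 < \<eta>" "M * \<eta> = \<delta> / 2" using \<delta> M by (auto simp: \<eta>_def)
  obtain T where T: "finite T" "cball (0::'a) 1 \<subseteq> (\<Union>x\<in>T. ball x \<eta>)"
  proof (rule compactE_image[OF compact_cball])
    show "cball (0::'a) 1 \<subseteq> (\<Union>x\<in>cball 0 1. ball x \<eta>)" using \<eta>(1) by auto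
  qed auto
  have "eventually (\<lambda>k. \<forall>x\<in>T. norm (v k x - \<Gamma> k x) < \<delta> / 2) sequentially"
    using T(1) null \<delta> by (intro eventually_ball_finite ballI) (use tendstoD[OF null, of "\<delta> / 2"] in \<open>auto simp: dist_norm\<close>)
  moreover have "eventually (\<lambda>k. norm (v k 0) < 1) sequentially"
    using tendstoD[OF zero, of 1] by (simp add: dist_norm)
  ultimately show ?thesis
  proof eventually_elim
    fix k assume k: "\<forall>x\<in>T. norm (v k x - \<Gamma> k x) < \<delta> / 2" and k0: "norm (v k 0) < 1"
    have basis: "norm (v k b) \<le> L + 1" if "b \<in> Basis" for b
      using lipschitz_on_normD[OF lip[of k], of b 0] k0 norm_triangle_ineq2[of "v k b" "v k 0"] that by simp
    have \<Gamma>bound: "norm (\<Gamma> k z) \<le> real DIM('a) * (L + 1) * norm z" for z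
    proof -
      have "norm (\<Gamma> k z) \<le> (\<Sum>b\<in>Basis. norm ((z \<bullet> b) *\<^sub>R v k b))"
        unfolding \<Gamma>_def by (rule norm_sum)
      also have "\<dots> \<le> (\<Sum>b\<in>(Basis::'a set). norm z * (L + 1))"
        using basis L by (intro sum_mono) (auto intro!: mult_mono simp: Basis_le_norm)
      finally show ?thesis by (simp add: algebra_simps)
    qed
    have "norm (v k z - \<Gamma> k z) \<le> \<delta>" if z: "z \<in> cball 0 1" for z
    proof -
      obtain x where x: "x \<in> T" "norm (z - x) < \<eta>" using T(2) z by (auto simp: dist_norm norm_minus_commute)
      have "norm (v k z - \<Gamma> k z) = norm ((v k x - \<Gamma> k x) + ((v k z - v k x) - \<Gamma> k (z - x)))"
        by (simp add: linear_diff[OF lin] algebra_simps)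
      also have "\<dots> \<le> norm (v k x - \<Gamma> k x) + (norm (v k z - v k x) + norm (\<Gamma> k (z - x)))"
        by (meson norm_triangle_ineq norm_triangle_ineq4 add_left_mono order_trans)
      also have "\<dots> \<le> \<delta> / 2 + (L * norm (z - x) + real DIM('a) * (L + 1) * norm (z - x))"
        using k x lipschitz_on_normD[OF lip[of k], of z x] \<Gamma>bound[of "z - x"] by (intro add_mono) auto
      also have "L * norm (z - x) + real DIM('a) * (L + 1) * norm (z - x) = M * norm (z - x)"
        by (simp add: M_def algebra_simps)
      also have "M * norm (z - x) \<le> M * \<eta>" using M x by simp
      finally show ?thesis using \<eta> by simp
    qed
    then show "\<exists>\<Gamma>. linear \<Gamma> \<and> (\<forall>z\<in>cball 0 1. norm (v k z - \<Gamma> z) \<le> \<delta>)"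
      using lin by blast
  qed
qed

text \<open>Null sets can be united over countably many \<open>c\<close> and \<open>e\<close> only;
  the common Lipschitz constant then carries the limit from a dense set to all of them.\<close>

lemma second_diff_null_extend:
  fixes v :: "nat \<Rightarrow> 'a::real_normed_vector \<Rightarrow> 'b::real_normed_vector"
  assumes lip: "\<And>k. L-lipschitz_on UNIV (v k)"
    and D: "\<And>S. open S \<Longrightarrow> S \<noteq> {} \<Longrightarrow> \<exists>d\<in>D. d \<in> S"
    and null: "\<And>c e. c \<in> D \<Longrightarrow> e \<in> D \<Longrightarrow> (\<lambda>k. second_diff (v k) e c) \<longlonglongrightarrow> 0"
  shows "(\<lambda>k. second_diff (v k) e c) \<longlonglongrightarrow> 0"
proof (rule tendstoI)
  fix \<epsilon> :: real assume \<epsilon>: "0 < \<epsilon>"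
  have L: "0 \<le> L" using lip lipschitz_on_nonneg by blast
  \<comment> \<open>Each of the three values moves by at most \<open>3 * L * d\<close>, with weights
    1, 2, 1. This costs \<open>12 * (L * d)\<close>, at most three quarters of \<epsilon>, and
    leaves a quarter for the tail. \<open>K\<close> replaces \<open>L\<close> as a positive
    divisor.\<close>
  define K where "K = L + 1"
  define d where "d = \<epsilon> / (16 * K)"
  have K: "0 < K" "L \<le> K" using L by (auto simp: K_def)
  have d: "0 < d" "K * d = \<epsilon> / 16" using \<epsilon> K by (auto simp: d_def)
  have Ld: "L * d \<le> \<epsilon> / 16" using mult_right_mono[OF K(2), of d] d by simp
  obtain c' where c': "c' \<in> D" "norm (c' - c) < d"
    using D[OF open_ball, of c d] d by (auto simp: dist_norm norm_minus_commute)
  obtain e' where e': "e' \<in> D" "norm (e' - e) < d"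
    using D[OF open_ball, of e d] d by (auto simp: dist_norm norm_minus_commute)
  have close: "norm (v k x - v k x') \<le> L * (3 * d)" if "norm (x - x') \<le> 3 * d" for k x x'
    using lipschitz_on_normD[OF lip, of x x' k] mult_left_mono[OF that L] by auto
  have "norm ((c + 2 *\<^sub>R e) - (c' + 2 *\<^sub>R e')) \<le> 3 * d"
  proof -
    have "norm ((c + 2 *\<^sub>R e) - (c' + 2 *\<^sub>R e')) = norm ((c - c') + 2 *\<^sub>R (e - e'))"
      by (simp add: algebra_simps)
    also have "\<dots> \<le> norm (c - c') + norm (2 *\<^sub>R (e - e'))" by (rule norm_triangle_ineq)
    finally show ?thesis using c' e' by (simp add: norm_minus_commute)
  qed
  moreover have "norm ((c + e) - (c' + e')) \<le> 3 * d"
  proof -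
    have "norm ((c + e) - (c' + e')) = norm ((c - c') + (e - e'))"
      by (simp add: algebra_simps)
    also have "\<dots> \<le> norm (c - c') + norm (e - e')" by (rule norm_triangle_ineq)
    finally show ?thesis using c' e' d by (simp add: norm_minus_commute)
  qed
  moreover have "norm (c - c') \<le> 3 * d" using c' d by (simp add: norm_minus_commute)
  ultimately have 1: "norm (v k (c + 2 *\<^sub>R e) - v k (c' + 2 *\<^sub>R e')) \<le> L * (3 * d)"
    "norm (v k (c + e) - v k (c' + e')) \<le> L * (3 * d)" "norm (v k c - v k c') \<le> L * (3 * d)" for k
    by (auto intro: close)
  have diff: "norm (second_diff (v k) e c) \<le> norm (second_diff (v k) e' c') + 12 * (L * d)" for k
  proof -
    have "norm (second_diff (v k) e c) = norm (second_diff (v k) e' c' 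
        + ((v k (c + 2 *\<^sub>R e) - v k (c' + 2 *\<^sub>R e')) + (- 2 *\<^sub>R (v k (c + e) - v k (c' + e')) + (v k c - v k c'))))"
      by (simp add: algebra_simps)
    also have "\<dots> \<le> norm (second_diff (v k) e' c') 
        + (norm (v k (c + 2 *\<^sub>R e) - v k (c' + 2 *\<^sub>R e')) + (norm (- 2 *\<^sub>R (v k (c + e) - v k (c' + e'))) + norm (v k c - v k c')))"
      by (intro norm_triangle_mono order_refl)
    also have "norm (- 2 *\<^sub>R (v k (c + e) - v k (c' + e'))) = 2 * norm (v k (c + e) - v k (c' + e'))"
      by simp
    finally show ?thesis using 1[of k] by linarith
  qed
  have "eventually (\<lambda>k. norm (second_diff (v k) e' c') < \<epsilon> / 4) sequentially"
    using tendstoD[OF null[OF c'(1) e'(1)], of "\<epsilon> / 4"] \<epsilon> by (simp add: dist_norm)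
  then show "eventually (\<lambda>k. dist (second_diff (v k) e c) 0 < \<epsilon>) sequentially"
  proof eventually_elim
    case (elim k)
    then show ?case using diff[of k] Ld \<epsilon> by simp
  qed
qed

section \<open>Approximation by linear maps almost everywhere\<close>

text \<open>The dyadic blow-ups of \<open>u\<close> at \<open>x\<close> are equi-Lipschitz, and off
  a null set their second differences tend to 0. They are therefore eventually close to linear maps
  on the unit ball; scaling back gives the estimate at radius \<open>(1/2) ^ k\<close>. The linear
  map may change with the scale.\<close>

proposition lipschitz_approx_linear_outside_negligible:
  fixes u :: "'a::euclidean_space \<Rightarrow> 'b::euclidean_space"
  assumes lip: "L-lipschitz_on UNIV u" and supp: "\<And>x. R < norm x \<Longrightarrow> u x = 0"
  obtains N where "negligible N"
    and "\<And>x \<delta> r\<^sub>0. \<lbrakk>x \<notin> N; 0 < \<delta>; 0 < r\<^sub>0\<rbrakk> \<Longrightarrow>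
      \<exists>r \<Gamma>. 0 < r \<and> r < r\<^sub>0 \<and> linear \<Gamma> \<and> (\<forall>s. norm s \<le> r \<longrightarrow> norm (u (x + s) - u x - \<Gamma> s) \<le> \<delta> * r)"
proof -
  obtain D :: "'a set" where D: "countable D" "\<And>S. open S \<Longrightarrow> S \<noteq> {} \<Longrightarrow> \<exists>d\<in>D. d \<in> S"
    using countable_dense_exists by blast
  have "AE x in lborel. \<forall>c\<in>D. \<forall>e\<in>D.
      (\<lambda>k. 2 ^ k *\<^sub>R second_diff u ((1/2) ^ k *\<^sub>R e) (x + (1/2) ^ k *\<^sub>R c)) \<longlonglongrightarrow> 0"
    unfolding AE_ball_countable[OF D(1)] using AE_second_diff_tendsto_0[OF lip, of R] supp by blast
  then obtain N where N: "N \<in> null_sets lborel"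
    and lim: "\<And>x c e. x \<notin> N \<Longrightarrow> c \<in> D \<Longrightarrow> e \<in> D \<Longrightarrow>
      (\<lambda>k. 2 ^ k *\<^sub>R second_diff u ((1/2) ^ k *\<^sub>R e) (x + (1/2) ^ k *\<^sub>R c)) \<longlonglongrightarrow> 0"
    by (auto elim!: AE_E3)
  have "negligible N"
    using N by (simp add: negligible_iff_null_sets null_sets_completionI)
  moreover have "\<exists>r \<Gamma>. 0 < r \<and> r < r\<^sub>0 \<and> linear \<Gamma> \<and> (\<forall>s. norm s \<le> r \<longrightarrow> norm (u (x + s) - u x - \<Gamma> s) \<le> \<delta> * r)"
    if x: "x \<notin> N" and \<delta>: "0 < \<delta>" and r0: "0 < r\<^sub>0" for x \<delta> r\<^sub>0
  proof -
    define v where "v k z = 2 ^ k *\<^sub>R (u (x + (1/2) ^ k *\<^sub>R z) - u x)" for k :: nat and z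
    have v_lip: "L-lipschitz_on UNIV (v k)" for k
    proof (rule lipschitz_onI)
      fix z w
      have "norm (u (x + (1/2) ^ k *\<^sub>R z) - u (x + (1/2) ^ k *\<^sub>R w)) \<le> L * norm ((1/2) ^ k *\<^sub>R z - (1/2) ^ k *\<^sub>R w)"
        using lipschitz_on_normD[OF lip, of "x + (1/2) ^ k *\<^sub>R z" "x + (1/2) ^ k *\<^sub>R w"] by simp
      then have "2 ^ k * norm (u (x + (1/2) ^ k *\<^sub>R z) - u (x + (1/2) ^ k *\<^sub>R w)) \<le> 2 ^ k * (L * ((1/2) ^ k * norm (z - w)))"
        by (intro mult_left_mono) (auto simp flip: scaleR_diff_right)
      also have "\<dots> = L * norm (z - w)" by (simp add: power_divide)
      finally show "dist (v k z) (v k w) \<le> L * dist z w"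
        by (simp add: v_def dist_norm flip: scaleR_diff_right)
    qed (rule lipschitz_on_nonneg[OF lip])
    have "second_diff (v k) e c = 2 ^ k *\<^sub>R second_diff u ((1/2) ^ k *\<^sub>R e) (x + (1/2) ^ k *\<^sub>R c)" for k e c
    proof -
      have "m *\<^sub>R (a - p) - 2 *\<^sub>R (m *\<^sub>R (b - p)) + m *\<^sub>R (d - p) = m *\<^sub>R (a - 2 *\<^sub>R b + d)"
        for m :: real and a b d p :: 'b
        unfolding scaleR_2 by (simp add: algebra_simps)
      moreover have "x + (1/2) ^ k *\<^sub>R (c + 2 *\<^sub>R e) = x + (1/2) ^ k *\<^sub>R c + 2 *\<^sub>R (1/2) ^ k *\<^sub>R e"
        "x + (1/2) ^ k *\<^sub>R (c + e) = x + (1/2) ^ k *\<^sub>R c + (1/2) ^ k *\<^sub>R e"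
        by (simp_all add: scaleR_add_right add.assoc)
      ultimately show ?thesis by (simp only: v_def)
    qed
    then have null: "(\<lambda>k. second_diff (v k) e c) \<longlonglongrightarrow> 0" for c e
      using second_diff_null_extend[OF v_lip D(2)] lim[OF x] by simp
    \<comment> \<open>The second differences along the segments from 0 to \<open>a + b\<close> and
      from \<open>a\<close> to \<open>b\<close> share the midpoint value; it cancels when they are
      subtracted, and \<open>v k 0 = 0\<close>.\<close>
    have add: "(\<lambda>k. v k (a + b) - v k a - v k b) \<longlonglongrightarrow> 0" for a b
    proof -
      have "a + 2 *\<^sub>R ((1/2) *\<^sub>R (b - a)) = b" by simp
      moreover have "a + (1/2) *\<^sub>R (b - a) = (1/2) *\<^sub>R (a + b)"
      proof -
        have "a = (1/2) *\<^sub>R a + (1/2) *\<^sub>R a" by (simp flip: scaleR_add_left)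
        then have "a + (1/2) *\<^sub>R (b - a) = ((1/2) *\<^sub>R a + (1/2) *\<^sub>R a) + (1/2) *\<^sub>R (b - a)" by simp
        then show ?thesis by (simp add: scaleR_diff_right scaleR_add_right)
      qed
      moreover have "v k 0 = 0" for k by (simp add: v_def)
      ultimately have "second_diff (v k) ((1/2) *\<^sub>R (a + b)) 0 - second_diff (v k) ((1/2) *\<^sub>R (b - a)) a
          = v k (a + b) - v k a - v k b" for k
        by (simp only:) simp
      then show ?thesis
        using tendsto_diff[OF null[where e = "(1/2) *\<^sub>R (a + b)" and c = 0] null[where e = "(1/2) *\<^sub>R (b - a)" and c = a]]
        by (simp only: diff_self)
    qed
    have "eventually (\<lambda>k. \<exists>\<Gamma>. linear \<Gamma> \<and> (\<forall>z\<in>cball 0 1. norm (v k z - \<Gamma> z) \<le> \<delta>)) sequentially"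
      by (rule additive_null_imp_eventually_linear[OF v_lip add \<delta>])
    moreover have "eventually (\<lambda>k. (1/2) ^ k < r\<^sub>0) sequentially"
      by (rule order_tendstoD[OF LIMSEQ_realpow_zero]) (use r0 in auto)
    ultimately have "eventually (\<lambda>k. (1/2) ^ k < r\<^sub>0 \<and>
        (\<exists>\<Gamma>. linear \<Gamma> \<and> (\<forall>z\<in>cball 0 1. norm (v k z - \<Gamma> z) \<le> \<delta>))) sequentially"
      by eventually_elim auto
    from eventually_happens'[OF sequentially_bot this]
    obtain k where k: "(1/2) ^ k < r\<^sub>0"
      and "\<exists>\<Gamma>. linear \<Gamma> \<and> (\<forall>z\<in>cball 0 1. norm (v k z - \<Gamma> z) \<le> \<delta>)"
      by blast
    then obtain \<Gamma> where lin: "linear \<Gamma>"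
      and \<Gamma>: "\<And>z. norm z \<le> 1 \<Longrightarrow> norm (v k z - \<Gamma> z) \<le> \<delta>"
      by auto
    have "norm (u (x + s) - u x - \<Gamma> s) \<le> \<delta> * (1/2) ^ k" if s: "norm s \<le> (1/2) ^ k" for s
    proof -
      have "norm (2 ^ k *\<^sub>R s) \<le> 2 ^ k * (1/2) ^ k" using s by simp
      then have "norm (2 ^ k *\<^sub>R s) \<le> 1" by (simp add: power_divide)
      then have "norm (v k (2 ^ k *\<^sub>R s) - \<Gamma> (2 ^ k *\<^sub>R s)) \<le> \<delta>" by (rule \<Gamma>)
      also have "v k (2 ^ k *\<^sub>R s) - \<Gamma> (2 ^ k *\<^sub>R s) = 2 ^ k *\<^sub>R (u (x + s) - u x - \<Gamma> s)"
        by (simp add: v_def power_divide linear_cmul[OF lin] scaleR_diff_right)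
      finally have "2 ^ k * norm (u (x + s) - u x - \<Gamma> s) \<le> \<delta>" by (simp only: norm_scaleR) simp
      then show ?thesis by (simp add: power_divide pos_le_divide_eq mult.commute)
    qed
    then show ?thesis using k lin by (intro exI[of _ "(1/2) ^ k"] exI[of _ \<Gamma>]) auto
  qed
  ultimately show thesis by (rule that)
qed

text \<open>Composing \<open>u\<close> with the projection to the ball and multiplying by a cutoff,
  equal to 1 on the ball and to 0 beyond radius \<open>2 * \<rho>\<close>, gives a globally
  Lipschitz function of bounded support. At scales below \<open>\<rho> - norm x\<close> it agrees
  with \<open>u\<close> near \<open>x\<close>.\<close>

corollary lipschitz_on_cball_approx_linear:
  fixes u :: "'a::euclidean_space \<Rightarrow> 'b::euclidean_space"
  assumes lip: "L-lipschitz_on (cball 0 \<rho>) u" and \<rho>: "0 < \<rho>"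
  obtains N where "negligible N"
    and "\<And>x \<delta> r\<^sub>0. \<lbrakk>x \<in> ball 0 \<rho> - N; 0 < \<delta>; 0 < r\<^sub>0\<rbrakk> \<Longrightarrow>
      \<exists>r \<Gamma>. 0 < r \<and> r < r\<^sub>0 \<and> linear \<Gamma> \<and> (\<forall>s. norm s \<le> r \<longrightarrow> norm (u (x + s) - u x - \<Gamma> s) \<le> \<delta> * r)"
proof -
  define P where "P = closest_point (cball (0::'a) \<rho>)"
  have P: "P x \<in> cball 0 \<rho>" for x
    unfolding P_def using \<rho> by (intro closest_point_in_set) auto
  have Plip: "norm (P x - P y) \<le> norm (x - y)" for x y
    unfolding P_def dist_norm[symmetric] using \<rho> by (intro closest_point_lipschitz) auto
  have L: "0 \<le> L" using lip by (rule lipschitz_on_nonneg)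
  have "compact (u ` cball 0 \<rho>)"
    using lip by (intro compact_continuous_image lipschitz_on_continuous_on) auto
  then obtain M where M: "\<And>x. x \<in> cball 0 \<rho> \<Longrightarrow> norm (u x) \<le> M"
    by (meson bounded_iff compact_imp_bounded imageI)
  have M0: "0 \<le> M" using M[of 0] \<rho> norm_ge_zero order_trans by (metis centre_in_cball less_imp_le)
  define \<theta> where "\<theta> x = max 0 (min 1 (2 - norm x / \<rho>))" for x :: 'a
  have \<theta>: "0 \<le> \<theta> x" "\<theta> x \<le> 1" for x by (auto simp: \<theta>_def)
  have \<theta>lip: "\<bar>\<theta> x - \<theta> y\<bar> \<le> norm (x - y) / \<rho>" for x y
  proof -
    have "\<bar>\<theta> x - \<theta> y\<bar> \<le> \<bar>norm x / \<rho> - norm y / \<rho>\<bar>" unfolding \<theta>_def by linarith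
    also have "\<dots> = \<bar>norm x - norm y\<bar> / \<rho>" using \<rho> by (simp flip: diff_divide_distrib)
    also have "\<dots> \<le> norm (x - y) / \<rho>"
      using \<rho> by (intro divide_right_mono norm_triangle_ineq3) auto
    finally show ?thesis .
  qed
  define w where "w x = \<theta> x *\<^sub>R u (P x)" for x
  have w_eq: "w x = u x" if "x \<in> cball 0 \<rho>" for x
    using that \<rho> by (simp add: w_def \<theta>_def P_def closest_point_self)
  have "(M / \<rho> + L)-lipschitz_on UNIV w"
  proof (rule lipschitz_onI)
    fix x y
    have "w x - w y = (\<theta> x - \<theta> y) *\<^sub>R u (P x) + \<theta> y *\<^sub>R (u (P x) - u (P y))"
      by (simp add: w_def algebra_simps)
    then have "norm (w x - w y) \<le> \<bar>\<theta> x - \<theta> y\<bar> * norm (u (P x)) + \<theta> y * norm (u (P x) - u (P y))"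
      using \<theta>(1)[of y] by (metis abs_of_nonneg norm_scaleR norm_triangle_ineq)
    also have "\<dots> \<le> norm (x - y) / \<rho> * M + 1 * (L * norm (x - y))"
    proof (intro add_mono mult_mono \<theta> \<theta>lip M P)
      have "norm (u (P x) - u (P y)) \<le> L * norm (P x - P y)"
        using lipschitz_on_normD[OF lip P P] .
      also have "\<dots> \<le> L * norm (x - y)" using L Plip by (intro mult_left_mono)
      finally show "norm (u (P x) - u (P y)) \<le> L * norm (x - y)" .
    qed (use \<rho> L in auto)
    finally show "dist (w x) (w y) \<le> (M / \<rho> + L) * dist x y"
      by (simp add: dist_norm algebra_simps)
  qed (use M0 L \<rho> in auto)
  moreover have "w x = 0" if "2 * \<rho> < norm x" for x
    using that \<rho> by (simp add: w_def \<theta>_def field_simps)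
  ultimately obtain N where N: "negligible N"
    and approx: "\<And>x \<delta> r\<^sub>0. \<lbrakk>x \<notin> N; 0 < \<delta>; 0 < r\<^sub>0\<rbrakk> \<Longrightarrow>
      \<exists>r \<Gamma>. 0 < r \<and> r < r\<^sub>0 \<and> linear \<Gamma> \<and> (\<forall>s. norm s \<le> r \<longrightarrow> norm (w (x + s) - w x - \<Gamma> s) \<le> \<delta> * r)"
    using lipschitz_approx_linear_outside_negligible[of "M / \<rho> + L" w "2 * \<rho>"] by metis
  have "\<exists>r \<Gamma>. 0 < r \<and> r < r\<^sub>0 \<and> linear \<Gamma> \<and> (\<forall>s. norm s \<le> r \<longrightarrow> norm (u (x + s) - u x - \<Gamma> s) \<le> \<delta> * r)"
    if x: "x \<in> ball 0 \<rho> - N" and \<delta>: "0 < \<delta>" and r0: "0 < r\<^sub>0" for x \<delta> r\<^sub>0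
  proof -
    have "0 < min r\<^sub>0 (\<rho> - norm x)" using x r0 by simp
    then obtain r \<Gamma> where r: "0 < r" "r < min r\<^sub>0 (\<rho> - norm x)" "linear \<Gamma>"
      and \<Gamma>: "\<And>s. norm s \<le> r \<Longrightarrow> norm (w (x + s) - w x - \<Gamma> s) \<le> \<delta> * r"
      using approx[of x \<delta> "min r\<^sub>0 (\<rho> - norm x)"] x \<delta> by auto
    have "norm (u (x + s) - u x - \<Gamma> s) \<le> \<delta> * r" if "norm s \<le> r" for s
    proof -
      have "norm (x + s) \<le> \<rho>" using norm_triangle_ineq[of x s] r that by simp
      then show ?thesis using \<Gamma>[OF that] w_eq[of x] w_eq[of "x + s"] x by simp
    qed
    then show ?thesis using r by auto
  qed
  with N show thesis by (rule that)
qed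

section \<open>Contact sets of semiconvex functions\<close>

text \<open>Reflecting through a contact point turns the plane above \<phi> into a lower bound: the
  plane minus \<open>C * (norm a)\<^sup>2\<close>. At \<open>x + v\<close> the lower bound from
  \<open>x\<close> meets the upper bound from \<open>y\<close>, so
  \<open>(p - q) \<bullet> v \<le> 3 * C * s\<^sup>2\<close> whenever \<open>norm v \<le> s\<close>;
  then \<open>v\<close> is taken along \<open>p - q\<close>. The room \<open>2 * s\<close> keeps the
  reflections in the ball. With \<open>y = x\<close> and \<open>s\<close> tending to 0 this also
  shows that contact gradients are unique.\<close>

lemma contact_gradients_close:
  fixes \<phi> :: "'a::euclidean_space \<Rightarrow> real"
  assumes semi: "\<And>x a. \<lbrakk>x + a \<in> cball 0 r; x - a \<in> cball 0 r\<rbrakk> \<Longrightarrow> 2 * \<phi> x \<le> \<phi> (x + a) + \<phi> (x - a) + C * (norm a)\<^sup>2"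
    and p: "\<And>z. z \<in> cball 0 r \<Longrightarrow> \<phi> z \<le> \<phi> x + p \<bullet> (z - x)"
    and q: "\<And>z. z \<in> cball 0 r \<Longrightarrow> \<phi> z \<le> \<phi> y + q \<bullet> (z - y)"
    and s: "0 < s" "norm (y - x) \<le> s" "norm x + 2 * s \<le> r" and C: "0 \<le> C"
  shows "norm (q - p) \<le> 3 * C * s"
proof -
  have lower: "\<phi> z + l \<bullet> a - C * (norm a)\<^sup>2 \<le> \<phi> (z + a)"
    if "\<And>w. w \<in> cball 0 r \<Longrightarrow> \<phi> w \<le> \<phi> z + l \<bullet> (w - z)" "z + a \<in> cball 0 r" "z - a \<in> cball 0 r" for z l a
    using semi[OF that(2,3)] that(1)[OF that(3)] by simp
  have inball: "x + a \<in> cball 0 r" if "norm a \<le> 2 * s" for a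
    using norm_triangle_ineq[of x a] that s by simp
  have sq: "C * (norm a)\<^sup>2 \<le> C * s\<^sup>2" if "norm a \<le> s" for a :: 'a
    using that C by (intro mult_left_mono power_mono) auto
  have y: "y \<in> cball 0 r" "x - (y - x) \<in> cball 0 r" "y - (x - y) \<in> cball 0 r" "x \<in> cball 0 r"
  proof -
    have "norm (2 *\<^sub>R (y - x)) \<le> 2 * s" using s by simp
    moreover have "y - (x - y) = x + 2 *\<^sub>R (y - x)" by (simp add: scaleR_2)
    ultimately show "y - (x - y) \<in> cball 0 r" using inball by metis
    show "y \<in> cball 0 r" using inball[of "y - x"] s by simp
    have "x - (y - x) = x + (x - y)" by simp
    then show "x - (y - x) \<in> cball 0 r" using inball[of "x - y"] s by (simp only:) (simp add: norm_minus_commute)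
    show "x \<in> cball 0 r" using inball[of 0] s by simp
  qed
  have "\<phi> x + p \<bullet> (y - x) - C * (norm (y - x))\<^sup>2 \<le> \<phi> y"
    using lower[of x p "y - x"] p y by simp
  moreover have "\<phi> y + q \<bullet> (x - y) - C * (norm (x - y))\<^sup>2 \<le> \<phi> x"
    using lower[of y q "x - y"] q y by simp
  ultimately have 1: "(p - q) \<bullet> (y - x) \<le> 2 * C * s\<^sup>2"
    using sq[of "y - x"] sq[of "x - y"] s by (simp add: inner_simps norm_minus_commute)
  have 2: "(p - q) \<bullet> v \<le> 3 * C * s\<^sup>2" if v: "norm v \<le> s" for v
  proof -
    have xv: "x + v \<in> cball 0 r" "x - v \<in> cball 0 r" using inball[of v] inball[of "- v"] v s by auto
    have "\<phi> x + p \<bullet> v - C * (norm v)\<^sup>2 \<le> \<phi> (x + v)" using lower[of x p v] p xv by simp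
    also have "\<dots> \<le> \<phi> y + q \<bullet> (x + v - y)" using q xv by simp
    also have "\<phi> y \<le> \<phi> x + p \<bullet> (y - x)" using p y by simp
    finally show ?thesis using 1 sq[OF v] by (simp add: inner_simps)
  qed
  show ?thesis
  proof (cases "q = p")
    case True
    then show ?thesis using C s by simp
  next
    case False
    define v where "v = (s / norm (p - q)) *\<^sub>R (p - q)"
    have "norm v \<le> s" using False s by (simp add: v_def)
    from 2[OF this] have "s * norm (p - q) \<le> s * (3 * C * s)"
      using False by (simp add: v_def power2_norm_eq_inner[symmetric] power2_eq_square mult_ac)
    then show ?thesis using s by (simp add: norm_minus_commute)
  qed
qed

text \<open>The set of contact gradients contains a ball, and it is a locally Lipschitz image of the
  contact set (Alexandrov--Bakelman--Pucci).\<close>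

proposition contact_set_not_negligible:
  fixes \<phi> :: "'a::euclidean_space \<Rightarrow> real"
  assumes r: "0 < r" and cont: "continuous_on (cball 0 r) \<phi>"
    and semi: "\<And>x a. \<lbrakk>x + a \<in> cball 0 r; x - a \<in> cball 0 r\<rbrakk> \<Longrightarrow> 2 * \<phi> x \<le> \<phi> (x + a) + \<phi> (x - a) + C * (norm a)\<^sup>2"
    and C: "0 \<le> C" and \<mu>: "0 < \<mu>" and peak: "\<And>x. norm x = r \<Longrightarrow> \<phi> x \<le> \<phi> 0 - \<mu>"
  shows "\<not> negligible {x \<in> ball 0 r. \<exists>p. \<forall>z\<in>cball 0 r. \<phi> z \<le> \<phi> x + p \<bullet> (z - x)}"
proof
  define E where "E = {x \<in> ball 0 r. \<exists>p. \<forall>z\<in>cball 0 r. \<phi> z \<le> \<phi> x + p \<bullet> (z - x)}"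
  define P where "P x = (SOME p. \<forall>z\<in>cball 0 r. \<phi> z \<le> \<phi> x + p \<bullet> (z - x))" for x
  have P: "\<phi> z \<le> \<phi> x + P x \<bullet> (z - x)" if "x \<in> E" "z \<in> cball 0 r" for x z
  proof -
    have "\<exists>p. \<forall>z\<in>cball 0 r. \<phi> z \<le> \<phi> x + p \<bullet> (z - x)" using that by (auto simp: E_def)
    from someI_ex[OF this] show ?thesis using that by (simp add: P_def)
  qed
  have P_eq: "P x = p" if x: "x \<in> E" and p: "\<And>z. z \<in> cball 0 r \<Longrightarrow> \<phi> z \<le> \<phi> x + p \<bullet> (z - x)" for x p
  proof (rule ccontr)
    assume neq: "P x \<noteq> p"
    have "0 < r - norm x" using x by (simp add: E_def)
    \<comment> \<open>Small enough for \<open>3 * C * s\<close> to be at most half of the supposed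
      distance of two gradients at the same point; \<open>C + 1\<close> avoids a zero
      divisor.\<close>
    define s where "s = min ((r - norm x) / 2) (norm (P x - p) / (6 * (C + 1)))"
    have s: "0 < s" using \<open>0 < r - norm x\<close> neq C by (simp add: s_def)
    have sx: "norm x + 2 * s \<le> r" using min.cobounded1[of "(r - norm x) / 2" "norm (P x - p) / (6 * (C + 1))"] by (simp add: s_def)
    have "norm (P x - p) \<le> 3 * C * s"
      by (rule contact_gradients_close[OF semi, where x = x and y = x]) (use p P[OF x] s sx C in auto)
    also have "\<dots> \<le> 3 * (C + 1) * s" using s by (simp add: algebra_simps)
    also have "\<dots> \<le> norm (P x - p) / 2"
    proof -
      have "s * (6 * (C + 1)) \<le> norm (P x - p)"
        using C by (subst pos_le_divide_eq[symmetric]) (auto simp: s_def)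
      then show ?thesis by (simp add: algebra_simps)
    qed
    finally show False using neq by simp
  qed
  assume "negligible {x \<in> ball 0 r. \<exists>p. \<forall>z\<in>cball 0 r. \<phi> z \<le> \<phi> x + p \<bullet> (z - x)}"
  then have "negligible E" by (simp add: E_def)
  have "negligible (P ` E)"
  proof (rule negligible_locally_Lipschitz_image[OF order_refl \<open>negligible E\<close>])
    fix x assume x: "x \<in> E"
    then have rx: "0 < r - norm x" by (simp add: E_def)
    have "norm (P y - P x) \<le> 3 * C * norm (y - x)" if y: "y \<in> E \<inter> ball x ((r - norm x) / 2)" for y
    proof (cases "y = x")
      case False
      show ?thesis
        by (rule contact_gradients_close[OF semi P[OF x]]) (use y P False C in \<open>auto simp: dist_norm norm_minus_commute\<close>)
    qed simp
    then show "\<exists>T B. open T \<and> x \<in> T \<and> (\<forall>y\<in>E \<inter> T. norm (P y - P x) \<le> B * norm (y - x))"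
      using rx by (intro exI[of _ "ball x ((r - norm x) / 2)"] exI[of _ "3 * C"]) auto
  qed
  moreover have "ball 0 (\<mu> / r) \<subseteq> P ` E"
  proof
    \<comment> \<open>A slope below \<open>\<mu> / r\<close> gains less than \<mu> on the ball, so
      the drop of \<phi> on the sphere keeps the maximum of \<open>\<phi> x - p \<bullet> x\<close>
      inside, and there \<open>p\<close> is a contact gradient.\<close>
    fix p :: 'a assume p: "p \<in> ball 0 (\<mu> / r)"
    have "continuous_on (cball 0 r) (\<lambda>x. \<phi> x - p \<bullet> x)" by (intro continuous_intros cont)
    then obtain x where x: "x \<in> cball 0 r" and max: "\<And>z. z \<in> cball 0 r \<Longrightarrow> \<phi> z - p \<bullet> z \<le> \<phi> x - p \<bullet> x"
      using continuous_attains_sup[of "cball 0 r" "\<lambda>x. \<phi> x - p \<bullet> x"] r by auto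
    have nr: "norm x \<noteq> r"
    proof
      assume nx: "norm x = r"
      have "- (p \<bullet> x) \<le> norm p * r" using norm_cauchy_schwarz[of "- p" x] nx by simp
      also have "\<dots> < \<mu>" using p r by (simp add: field_simps)
      finally show False using peak[OF nx] max[of 0] r by simp
    qed
    have contact: "\<phi> z \<le> \<phi> x + p \<bullet> (z - x)" if "z \<in> cball 0 r" for z
      using max[OF that] by (simp add: inner_simps)
    then have "\<exists>p. \<forall>z\<in>cball 0 r. \<phi> z \<le> \<phi> x + p \<bullet> (z - x)" by blast
    moreover have "x \<in> ball 0 r" using x nr by simp
    ultimately have "x \<in> E" by (simp add: E_def)
    then show "p \<in> P ` E" using P_eq[of x p] contact by auto
  qed
  moreover have "\<not> negligible (ball (0::'a) (\<mu> / r))"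
    using divide_pos_pos[OF \<mu> r] by (intro open_not_negligible) auto
  ultimately show False using negligible_subset by blast
qed

section \<open>Strongly convex fibres: contact along the argmin\<close>

text \<open>At a point where the marginal lies below a strictly concave paraboloid and \<gamma> is
  close to a linear \<Gamma> at scale \<open>q\<close>, the test function \<open>Q\<close> dominates
  \<open>h\<close> up to an error smaller than the gain of \<open>Q\<close> on the boundary of a box
  of size \<open>q\<close>. So \<open>h - Q\<close> has a maximum in the interior of the box, and
  this is the contact point. The term \<open>\<sigma> * (norm t)\<^sup>2\<close> left in the
  conclusion matches a term \<open>\<sigma> * (norm y)\<^sup>2\<close> that the caller has added to
  its function.\<close>

lemma argmin_contact:
  fixes h :: "'a::euclidean_space \<times> 'b::euclidean_space \<Rightarrow> real"
  assumes r: "0 < r" and \<sigma>: "0 < \<sigma>" and \<tau>: "0 \<le> \<tau>" and \<kappa>: "0 \<le> \<kappa>" and \<mu>: "0 < \<mu>"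
    and cont: "continuous_on UNIV h"
    and convex: "\<And>x y a b. 2 * h (x, y) \<le> h (x + a, y + b) + h (x - a, y - b) + 2 * \<tau> * (norm a)\<^sup>2 - 2 * \<sigma> * (norm b)\<^sup>2"
    and concave: "\<And>x y a b. \<lbrakk>y + b \<in> cball 0 (R + 1); y - b \<in> cball 0 (R + 1)\<rbrakk> \<Longrightarrow>
        h (x + a, y + b) + h (x - a, y - b) \<le> 2 * h (x, y) + 2 * \<kappa> * ((norm a)\<^sup>2 + (norm b)\<^sup>2)"
    and \<gamma>: "\<And>x. x \<in> cball 0 r \<Longrightarrow> \<gamma> x \<in> cball 0 R"
    and argmin: "\<And>x y. x \<in> cball 0 r \<Longrightarrow> h (x, \<gamma> x) \<le> h (x, y)"
    and peak: "\<And>x. norm x = r \<Longrightarrow> h (x, \<gamma> x) \<le> h (0, \<gamma> 0) - \<mu>"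
  obtains x y p\<^sub>1 p\<^sub>2 \<Gamma> K d where "x \<in> ball 0 r" "y \<in> cball 0 (R + 1)" "linear \<Gamma>" "0 < d"
    and "\<And>s t. \<lbrakk>norm s < d; norm t < d\<rbrakk> \<Longrightarrow>
      h (x + s, y + t) \<le> h (x, y) + p\<^sub>1 \<bullet> s + p\<^sub>2 \<bullet> t + K * (norm (t - \<Gamma> s))\<^sup>2 + \<sigma> * (norm t)\<^sup>2"
proof -
  define G where "G x = h (x, \<gamma> x)" for x
  define \<Lambda> where "\<Lambda> = sqrt ((\<kappa> + \<tau>) / \<sigma>)"
  have \<Lambda>: "0 \<le> \<Lambda>" using \<sigma> \<tau> \<kappa> by (simp add: \<Lambda>_def)
  \<comment> \<open>The midpoint of the two argmins is a competitor at \<open>x\<close>. The gain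
    from strong convexity is retained: compared with \<open>G_concave\<close> it bounds the
    increments of \<gamma>, with constant \<Lambda>.\<close>
  have G_convex: "2 * G x \<le> G (x + a) + G (x - a) + 2 * \<tau> * (norm a)\<^sup>2
      - 2 * \<sigma> * (norm ((1/2) *\<^sub>R (\<gamma> (x + a) - \<gamma> (x - a))))\<^sup>2"
    if "x \<in> cball 0 r" for x a
  proof -
    define y where "y = (1/2) *\<^sub>R (\<gamma> (x + a) + \<gamma> (x - a))"
    define b where "b = (1/2) *\<^sub>R (\<gamma> (x + a) - \<gamma> (x - a))"
    have "y + b = \<gamma> (x + a)" "y - b = \<gamma> (x - a)"
      by (simp_all add: y_def b_def algebra_simps flip: scaleR_add_left)
    then show ?thesis
      using convex[of x y a b] argmin[OF that, of y] by (simp add: G_def b_def)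
  qed
  have midpoint: "x \<in> cball 0 r" if "x + a \<in> cball 0 r" "x - a \<in> cball 0 r" for x a :: 'a
  proof -
    have "norm (2 *\<^sub>R x) = norm ((x + a) + (x - a))" by (simp add: scaleR_2)
    also have "\<dots> \<le> norm (x + a) + norm (x - a)" by (rule norm_triangle_ineq)
    finally show ?thesis using that by simp
  qed
  have G_concave: "G (x + a) + G (x - a) \<le> 2 * G x + 2 * \<kappa> * (norm a)\<^sup>2"
    if "x + a \<in> cball 0 r" "x - a \<in> cball 0 r" for x a
  proof -
    have "\<gamma> x \<in> cball 0 (R + 1)" using \<gamma>[OF midpoint[OF that]] by simp
    then show ?thesis
      using concave[of "\<gamma> x" 0 x a] argmin[OF that(1), of "\<gamma> x"] argmin[OF that(2), of "\<gamma> x"]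
      by (simp add: G_def)
  qed
  have \<gamma>_lip: "\<Lambda>-lipschitz_on (cball 0 r) \<gamma>"
  proof (rule lipschitz_onI[OF _ \<Lambda>])
    fix x1 x2 :: 'a assume x12: "x1 \<in> cball 0 r" "x2 \<in> cball 0 r"
    define x where "x = (1/2) *\<^sub>R (x1 + x2)"
    define a where "a = (1/2) *\<^sub>R (x1 - x2)"
    have eq: "x + a = x1" "x - a = x2"
      by (simp_all add: x_def a_def algebra_simps flip: scaleR_add_left)
    then have "x \<in> cball 0 r" using midpoint[of x a] x12 by simp
    have "2 * \<sigma> * (norm ((1/2) *\<^sub>R (\<gamma> x1 - \<gamma> x2)))\<^sup>2 \<le> 2 * \<kappa> * (norm a)\<^sup>2 + 2 * \<tau> * (norm a)\<^sup>2"
      using G_convex[OF \<open>x \<in> cball 0 r\<close>, of a, unfolded eq] G_concave[of x a, unfolded eq, OF x12] by linarith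
    then have "\<sigma> * (norm (\<gamma> x1 - \<gamma> x2))\<^sup>2 \<le> \<kappa> * (norm (x1 - x2))\<^sup>2 + \<tau> * (norm (x1 - x2))\<^sup>2"
      by (simp add: a_def power_divide)
    then have "(norm (\<gamma> x1 - \<gamma> x2))\<^sup>2 \<le> ((\<kappa> + \<tau>) / \<sigma>) * (norm (x1 - x2))\<^sup>2"
      using \<sigma> by (simp add: field_simps)
    then have "sqrt ((norm (\<gamma> x1 - \<gamma> x2))\<^sup>2) \<le> sqrt (((\<kappa> + \<tau>) / \<sigma>) * (norm (x1 - x2))\<^sup>2)"
      by (rule real_sqrt_le_mono)
    then show "dist (\<gamma> x1) (\<gamma> x2) \<le> \<Lambda> * dist x1 x2"
      unfolding real_sqrt_mult by (simp add: \<Lambda>_def dist_norm)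
  qed
  \<comment> \<open>The opposite point \<open>\<gamma> x - v\<close> has a value of at least
    \<open>G x\<close>, so the midpoint inequality bounds the value at
    \<open>\<gamma> x + v\<close>.\<close>
  have upper: "h (x, \<gamma> x + v) \<le> G x + 2 * \<kappa> * (norm v)\<^sup>2" if x: "x \<in> cball 0 r" and v: "norm v \<le> 1" for x v
  proof -
    have "\<gamma> x + v \<in> cball 0 (R + 1)" "\<gamma> x - v \<in> cball 0 (R + 1)"
      using \<gamma>[OF x] v norm_triangle_ineq[of "\<gamma> x" v] norm_triangle_ineq4[of "\<gamma> x" v] by auto
    then show ?thesis using concave[of "\<gamma> x" v x 0] argmin[OF x, of "\<gamma> x - v"] by (simp add: G_def)
  qed
  obtain N where N: "negligible N" and approx: "\<And>x \<delta> r\<^sub>0. \<lbrakk>x \<in> ball 0 r - N; 0 < \<delta>; 0 < r\<^sub>0\<rbrakk> \<Longrightarrow>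
      \<exists>q \<Gamma>. 0 < q \<and> q < r\<^sub>0 \<and> linear \<Gamma> \<and> (\<forall>s. norm s \<le> q \<longrightarrow> norm (\<gamma> (x + s) - \<gamma> x - \<Gamma> s) \<le> \<delta> * q)"
    using lipschitz_on_cball_approx_linear[OF \<gamma>_lip r] by metis
  \<comment> \<open>Adding \<open>\<epsilon> * (norm x)\<^sup>2\<close> uses up half of the peak; a
    plane touching \<phi> from above is then a paraboloid with Hessian
    \<open>- 2 * \<epsilon>\<close> touching \<open>G\<close>.\<close>
  define \<epsilon> where "\<epsilon> = \<mu> / (2 * r\<^sup>2)"
  have \<epsilon>: "0 < \<epsilon>" "\<epsilon> * r\<^sup>2 = \<mu> / 2" using \<mu> r by (auto simp: \<epsilon>_def)
  define \<phi> where "\<phi> x = G x + \<epsilon> * (norm x)\<^sup>2" for x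
  define E where "E = {x \<in> ball 0 r. \<exists>p. \<forall>z\<in>cball 0 r. \<phi> z \<le> \<phi> x + p \<bullet> (z - x)}"
  have "\<not> negligible E"
    unfolding E_def
  proof (rule contact_set_not_negligible[where C = "2 * \<tau>" and \<mu> = "\<mu> / 2"])
    have "continuous_on (cball 0 r) G"
      unfolding G_def using lipschitz_on_continuous_on[OF \<gamma>_lip]
      by (intro continuous_on_compose2[OF cont] continuous_intros) auto
    then show "continuous_on (cball 0 r) \<phi>"
      unfolding \<phi>_def by (intro continuous_intros)
    show "2 * \<phi> x \<le> \<phi> (x + a) + \<phi> (x - a) + 2 * \<tau> * (norm a)\<^sup>2"
      if "x + a \<in> cball 0 r" "x - a \<in> cball 0 r" for x a
    proof -
      have "(norm (x + a))\<^sup>2 + (norm (x - a))\<^sup>2 = 2 * (norm x)\<^sup>2 + 2 * (norm a)\<^sup>2"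
        by (simp add: power2_norm_eq_inner inner_simps inner_commute)
      then have "\<epsilon> * (norm (x + a))\<^sup>2 + \<epsilon> * (norm (x - a))\<^sup>2 = 2 * (\<epsilon> * (norm x)\<^sup>2) + 2 * (\<epsilon> * (norm a)\<^sup>2)"
        by (metis (no_types, opaque_lifting) distrib_left mult.left_commute)
      moreover have "0 \<le> \<epsilon> * (norm a)\<^sup>2" using \<epsilon> by simp
      moreover have "0 \<le> \<sigma> * (norm ((1/2) *\<^sub>R (\<gamma> (x + a) - \<gamma> (x - a))))\<^sup>2" using \<sigma> by simp
      ultimately show ?thesis using G_convex[OF midpoint[OF that], of a] by (simp add: \<phi>_def)
    qed
    show "\<phi> x \<le> \<phi> 0 - \<mu> / 2" if "norm x = r" for x
      using peak[OF that] \<epsilon> that by (simp add: \<phi>_def G_def)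
  qed (use r \<tau> \<mu> in auto)
  then obtain x where x: "x \<in> E" "x \<notin> N" using N negligible_subset by blast
  then obtain p where xr: "x \<in> ball 0 r" and p: "\<And>z. z \<in> cball 0 r \<Longrightarrow> \<phi> z \<le> \<phi> x + p \<bullet> (z - x)"
    unfolding E_def by blast
  define p' where "p' = p - (2 * \<epsilon>) *\<^sub>R x"
  have contact: "G (x + s) \<le> G x + p' \<bullet> s - \<epsilon> * (norm s)\<^sup>2" if "x + s \<in> cball 0 r" for s
  proof -
    have "(norm (x + s))\<^sup>2 = (norm x)\<^sup>2 + 2 * (x \<bullet> s) + (norm s)\<^sup>2"
      by (simp add: power2_norm_eq_inner inner_simps inner_commute)
    then show ?thesis using p[OF that] by (simp add: \<phi>_def p'_def inner_simps algebra_simps)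
  qed
  \<comment> \<open>The term with \<beta> in \<open>Q\<close> must be absorbed by the concavity
    \<epsilon> in \<open>s\<close> and by the allowance \<sigma> in \<open>t\<close>. Next, \<delta>
    makes the linearisation error \<open>4 * \<kappa> * (\<delta> * q)\<^sup>2\<close> smaller than
    \<open>\<beta> * q\<^sup>2\<close>.\<close>
  define \<beta> where "\<beta> = min \<epsilon> \<sigma>"
  have \<beta>: "0 < \<beta>" "\<beta> \<le> \<epsilon>" "\<beta> \<le> \<sigma>" using \<epsilon> \<sigma> by (auto simp: \<beta>_def)
  define \<delta> where "\<delta> = sqrt (\<beta> / (8 * (\<kappa> + 1)))"
  have \<delta>: "0 < \<delta>" "4 * \<kappa> * \<delta>\<^sup>2 < \<beta>"
  proof -
    show "0 < \<delta>" using \<beta> \<kappa> by (simp add: \<delta>_def)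
    have "\<delta>\<^sup>2 = \<beta> / (8 * (\<kappa> + 1))" using \<beta> \<kappa> by (simp add: \<delta>_def)
    then have "4 * \<kappa> * \<delta>\<^sup>2 = \<beta> * (4 * \<kappa> / (8 * (\<kappa> + 1)))" by simp
    also have "\<dots> < \<beta> * 1" using \<beta> \<kappa> by (intro mult_strict_left_mono) auto
    finally show "4 * \<kappa> * \<delta>\<^sup>2 < \<beta>" by simp
  qed
  \<comment> \<open>The bound \<open>1 / (1 + \<Lambda>)\<close> keeps the distance from
    \<open>\<gamma> x + t\<close> to \<open>\<gamma> (x + s)\<close> below 1, as
    \<open>upper\<close> requires.\<close>
  have "0 < min (r - norm x) (1 / (1 + \<Lambda>))" using xr \<Lambda> by simp
  then obtain q \<Gamma> where q: "0 < q" "q < min (r - norm x) (1 / (1 + \<Lambda>))" and lin: "linear \<Gamma>"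
    and \<Gamma>: "\<And>s. norm s \<le> q \<Longrightarrow> norm (\<gamma> (x + s) - \<gamma> x - \<Gamma> s) \<le> \<delta> * q"
    using approx[of x \<delta> "min (r - norm x) (1 / (1 + \<Lambda>))"] x xr \<delta>(1) by auto
  have q1: "(1 + \<Lambda>) * q < 1" using q \<Lambda> by (simp add: field_simps)
  have xs: "x + s \<in> cball 0 r" if "norm s \<le> q" for s
    using norm_triangle_ineq[of x s] that q by simp
  \<comment> \<open>The coefficient \<open>2 * \<kappa>\<close> of \<open>upper\<close> doubles
    because \<open>v\<close> is \<open>t - \<Gamma> s\<close> minus the linearisation error
    \<open>e\<close>, and the square of a difference is at most twice the sum of the
    squares.\<close>
  define Q where "Q s t = p' \<bullet> s + 4 * \<kappa> * (norm (t - \<Gamma> s))\<^sup>2 - \<epsilon> * (norm s)\<^sup>2 + \<beta> * ((norm s)\<^sup>2 + (norm t)\<^sup>2)" for s t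
  have near: "h (x + s, \<gamma> x + t) - Q s t \<le> G x + 4 * \<kappa> * (\<delta> * q)\<^sup>2 - \<beta> * ((norm s)\<^sup>2 + (norm t)\<^sup>2)"
    if s: "norm s \<le> q" and t: "norm t \<le> q" for s t
  proof -
    define e where "e = \<gamma> (x + s) - \<gamma> x - \<Gamma> s"
    define v where "v = t - \<Gamma> s - e"
    have "norm (\<gamma> (x + s) - \<gamma> x) \<le> \<Lambda> * norm s"
      using lipschitz_on_normD[OF \<gamma>_lip, of "x + s" x] xs[OF s] xs[of 0] q by simp
    also have "\<dots> \<le> \<Lambda> * q" using \<Lambda> s by (intro mult_left_mono)
    finally have "norm v \<le> 1"
      using norm_triangle_ineq4[of t "\<gamma> (x + s) - \<gamma> x"] t q1 by (simp add: v_def e_def algebra_simps)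
    from upper[OF xs[OF s] this]
    have "h (x + s, \<gamma> x + t) \<le> G (x + s) + 2 * \<kappa> * (norm v)\<^sup>2"
      by (simp add: v_def e_def algebra_simps)
    moreover have "(norm v)\<^sup>2 \<le> 2 * (norm (t - \<Gamma> s))\<^sup>2 + 2 * (\<delta> * q)\<^sup>2"
    proof -
      have "(norm v)\<^sup>2 + (norm ((t - \<Gamma> s) + e))\<^sup>2 = 2 * (norm (t - \<Gamma> s))\<^sup>2 + 2 * (norm e)\<^sup>2"
        unfolding v_def by (simp add: power2_norm_eq_inner inner_simps inner_commute)
      moreover have "(norm e)\<^sup>2 \<le> (\<delta> * q)\<^sup>2" using \<Gamma>[OF s] by (intro power_mono) (auto simp: e_def)
      ultimately show ?thesis using zero_le_power2[of "norm ((t - \<Gamma> s) + e)"] by linarith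
    qed
    then have "2 * \<kappa> * (norm v)\<^sup>2 \<le> 2 * \<kappa> * (2 * (norm (t - \<Gamma> s))\<^sup>2 + 2 * (\<delta> * q)\<^sup>2)"
      using \<kappa> by (intro mult_left_mono) auto
    ultimately show ?thesis using contact[OF xs[OF s]] by (simp add: Q_def algebra_simps)
  qed
  have cont_Q: "continuous_on (cball 0 q \<times> cball 0 q) (\<lambda>w. h (x + fst w, \<gamma> x + snd w) - Q (fst w) (snd w))"
    unfolding Q_def
    by (intro continuous_intros continuous_on_compose2[OF cont] linear_continuous_on_compose[OF _ lin]) auto
  have "compact (cball (0::'a) q \<times> cball (0::'b) q)" "cball (0::'a) q \<times> cball (0::'b) q \<noteq> {}"
    using q by (auto intro: compact_Times)
  from continuous_attains_sup[OF this cont_Q]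
  obtain w where w: "w \<in> cball 0 q \<times> cball 0 q"
    and wmax: "\<forall>z\<in>cball 0 q \<times> cball 0 q. h (x + fst z, \<gamma> x + snd z) - Q (fst z) (snd z)
      \<le> h (x + fst w, \<gamma> x + snd w) - Q (fst w) (snd w)"
    by (elim bexE)
  obtain s0 t0 where st0: "w = (s0, t0)" by (cases w)
  have n0: "norm s0 \<le> q" "norm t0 \<le> q" using w by (auto simp: st0)
  have max: "h (x + s, \<gamma> x + t) - Q s t \<le> h (x + s0, \<gamma> x + t0) - Q s0 t0" if "norm s \<le> q" "norm t \<le> q" for s t
    using bspec[OF wmax, of "(s, t)"] that by (simp add: st0)
  \<comment> \<open>The value at the centre is \<open>G x\<close>, so \<open>near\<close> leaves a
    maximiser only where the \<beta> term is at most the linearisation error.\<close>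
  have interior: "norm s0 < q" "norm t0 < q"
  proof -
    have "G x \<le> h (x + s0, \<gamma> x + t0) - Q s0 t0"
      using max[of 0 0] q by (simp add: Q_def G_def linear_0[OF lin])
    also note near[OF n0]
    finally have "\<beta> * ((norm s0)\<^sup>2 + (norm t0)\<^sup>2) \<le> (4 * \<kappa> * \<delta>\<^sup>2) * q\<^sup>2"
      by (simp add: power_mult_distrib)
    also have "\<dots> < \<beta> * q\<^sup>2" using \<delta> q by (intro mult_strict_right_mono) auto
    finally have lt: "(norm s0)\<^sup>2 + (norm t0)\<^sup>2 < q\<^sup>2" using \<beta> by simp
    then have "(norm s0)\<^sup>2 < q\<^sup>2" "(norm t0)\<^sup>2 < q\<^sup>2"
      using zero_le_power2[of "norm s0"] zero_le_power2[of "norm t0"] by linarith+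
    then show "norm s0 < q" "norm t0 < q" using q power2_less_imp_less[of _ q] by auto
  qed
  show thesis
  \<comment> \<open>The slopes are the partial gradients of \<open>Q\<close> at
    \<open>(s0, t0)\<close>; what remains of second order is
    \<open>4 * \<kappa> * (norm (t - \<Gamma> s))\<^sup>2\<close> plus terms controlled by the
    choice of \<beta>.\<close>
  proof (rule that[of "x + s0" "\<gamma> x + t0" \<Gamma> "min (q - norm s0) (q - norm t0)"
        "p' - (8 * \<kappa>) *\<^sub>R adjoint \<Gamma> (t0 - \<Gamma> s0) - (2 * \<epsilon>) *\<^sub>R s0 + (2 * \<beta>) *\<^sub>R s0"
        "(8 * \<kappa>) *\<^sub>R (t0 - \<Gamma> s0) + (2 * \<beta>) *\<^sub>R t0" "4 * \<kappa>"])
    show "x + s0 \<in> ball 0 r" using norm_triangle_ineq[of x s0] interior q by simp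
    have "1 * q \<le> (1 + \<Lambda>) * q" using q \<Lambda> by (intro mult_right_mono) auto
    then have "q < 1" using q1 by linarith
    then show "\<gamma> x + t0 \<in> cball 0 (R + 1)"
      using norm_triangle_ineq[of "\<gamma> x" t0] n0 \<gamma>[of x] xr by simp
    show "linear \<Gamma>" by (rule lin)
    show "0 < min (q - norm s0) (q - norm t0)" using interior by simp
    fix s :: 'a and t :: 'b
    assume s: "norm s < min (q - norm s0) (q - norm t0)" and t: "norm t < min (q - norm s0) (q - norm t0)"
    have "norm (s0 + s) \<le> q" "norm (t0 + t) \<le> q"
      using norm_triangle_ineq[of s0 s] norm_triangle_ineq[of t0 t] s t by auto
    from max[OF this] have "h (x + s0 + s, \<gamma> x + t0 + t) \<le> h (x + s0, \<gamma> x + t0) + (Q (s0 + s) (t0 + t) - Q s0 t0)"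
      by (simp add: add.assoc)
    also have "Q (s0 + s) (t0 + t) - Q s0 t0
        = p' \<bullet> s + 4 * \<kappa> * (2 * ((t0 - \<Gamma> s0) \<bullet> (t - \<Gamma> s)) + (norm (t - \<Gamma> s))\<^sup>2)
          - \<epsilon> * (2 * (s0 \<bullet> s) + (norm s)\<^sup>2) + \<beta> * (2 * (s0 \<bullet> s) + (norm s)\<^sup>2 + 2 * (t0 \<bullet> t) + (norm t)\<^sup>2)"
    proof -
      have ex: "(norm (a + b))\<^sup>2 = (norm a)\<^sup>2 + (2 * (a \<bullet> b) + (norm b)\<^sup>2)" for a b :: "'c::real_inner"
        by (simp add: power2_norm_eq_inner inner_simps inner_commute)
      have "t0 + t - \<Gamma> (s0 + s) = (t0 - \<Gamma> s0) + (t - \<Gamma> s)" by (simp add: linear_add[OF lin])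
      then show ?thesis by (simp only: Q_def ex inner_add_right) (simp add: algebra_simps)
    qed
    also have "(t0 - \<Gamma> s0) \<bullet> (t - \<Gamma> s) = (t0 - \<Gamma> s0) \<bullet> t - adjoint \<Gamma> (t0 - \<Gamma> s0) \<bullet> s"
      by (simp add: inner_diff_right adjoint_works[OF lin] inner_commute[of "adjoint \<Gamma> _"] inner_commute[of "\<Gamma> s"]
          inner_diff_left)
    finally have "h (x + s0 + s, \<gamma> x + t0 + t) \<le> h (x + s0, \<gamma> x + t0)
        + (p' - (8 * \<kappa>) *\<^sub>R adjoint \<Gamma> (t0 - \<Gamma> s0) - (2 * \<epsilon>) *\<^sub>R s0 + (2 * \<beta>) *\<^sub>R s0) \<bullet> s
        + ((8 * \<kappa>) *\<^sub>R (t0 - \<Gamma> s0) + (2 * \<beta>) *\<^sub>R t0) \<bullet> t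
        + 4 * \<kappa> * (norm (t - \<Gamma> s))\<^sup>2 + (\<beta> * (norm s)\<^sup>2 - \<epsilon> * (norm s)\<^sup>2) + \<beta> * (norm t)\<^sup>2"
      by (simp add: inner_diff_left inner_add_left algebra_simps)
    moreover have "\<beta> * (norm s)\<^sup>2 \<le> \<epsilon> * (norm s)\<^sup>2" "\<beta> * (norm t)\<^sup>2 \<le> \<sigma> * (norm t)\<^sup>2"
      using \<beta> by (auto intro!: mult_right_mono)
    ultimately show "h (x + s0 + s, \<gamma> x + t0 + t) \<le> h (x + s0, \<gamma> x + t0)
        + (p' - (8 * \<kappa>) *\<^sub>R adjoint \<Gamma> (t0 - \<Gamma> s0) - (2 * \<epsilon>) *\<^sub>R s0 + (2 * \<beta>) *\<^sub>R s0) \<bullet> s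
        + ((8 * \<kappa>) *\<^sub>R (t0 - \<Gamma> s0) + (2 * \<beta>) *\<^sub>R t0) \<bullet> t
        + 4 * \<kappa> * (norm (t - \<Gamma> s))\<^sup>2 + \<sigma> * (norm t)\<^sup>2"
      by linarith
  qed
qed

section \<open>Partial sup-convolution\<close>

text \<open>Uniform continuity on a compact neighbourhood bounds the change of \<Psi> simultaneously
  for all \<open>x\<close> in \<open>W\<close>; comparing maximisers at the two points transfers the
  bound to the maximum.\<close>

lemma continuous_on_max_over_compact:
  fixes \<Psi> :: "'a::euclidean_space \<times> 'b::metric_space \<Rightarrow> real"
  assumes W: "compact W" and cont: "continuous_on (UNIV \<times> W) \<Psi>"
    and upper: "\<And>z x. x \<in> W \<Longrightarrow> \<Psi> (z, x) \<le> h z" and attained: "\<And>z. \<exists>x\<in>W. h z = \<Psi> (z, x)"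
  shows "continuous_on UNIV h"
proof -
  have "\<exists>d>0. \<forall>z'. dist z' z < d \<longrightarrow> dist (h z') (h z) < e" if e: "0 < e" for z e
  proof -
    have "uniformly_continuous_on (cball z 1 \<times> W) \<Psi>"
      by (intro compact_uniformly_continuous continuous_on_subset[OF cont] compact_Times W compact_cball) auto
    then obtain d where d: "0 < d"
      and close: "\<And>p p'. \<lbrakk>p \<in> cball z 1 \<times> W; p' \<in> cball z 1 \<times> W; dist p' p < d\<rbrakk> \<Longrightarrow> dist (\<Psi> p') (\<Psi> p) < e"
      unfolding uniformly_continuous_on_def using e by metis
    have "dist (h z') (h z) < e" if "dist z' z < min d 1" for z'
    proof -
      have *: "dist (\<Psi> (z', x)) (\<Psi> (z, x)) < e" if "x \<in> W" for x
        using \<open>dist z' z < min d 1\<close> that by (intro close) (auto simp: dist_commute dist_Pair_Pair)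
      obtain x x' where x: "x \<in> W" "h z = \<Psi> (z, x)" "x' \<in> W" "h z' = \<Psi> (z', x')"
        using attained by metis
      show ?thesis
        using *[OF x(1)] *[OF x(3)] upper[OF x(1), of z'] upper[OF x(3), of z] x(2,4)
        unfolding dist_real_def by linarith
    qed
    with d show ?thesis by (intro exI[of _ "min d 1"]) auto
  qed
  then show ?thesis by (simp add: continuous_on_iff)
qed

text \<open>Partial sup-convolution makes the semiconcave \<open>u\<close> semiconvex as well.\<close>

lemma partial_sup_convolution:
  fixes u :: "'a::euclidean_space \<times> 'b::euclidean_space \<Rightarrow> real"
  assumes W: "compact W" "convex W" "W \<noteq> {}" and cont: "continuous_on (W \<times> UNIV) u"
  obtains h where "continuous_on UNIV h"
    and "\<And>x y x'. x' \<in> W \<Longrightarrow> u (x', y) - \<tau> * (norm (x - x'))\<^sup>2 \<le> h (x, y)"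
    and "\<And>x y. \<exists>x'\<in>W. h (x, y) = u (x', y) - \<tau> * (norm (x - x'))\<^sup>2"
proof -
  define \<Psi> where "\<Psi> = (\<lambda>((x, y), x'). u (x', y) - \<tau> * (norm (x - x'))\<^sup>2)"
  have \<Psi>: "continuous_on (UNIV \<times> W) \<Psi>"
    unfolding \<Psi>_def case_prod_unfold
    by (intro continuous_intros continuous_on_compose2[OF cont]) auto
  have ex: "\<exists>x\<in>W. \<forall>x'\<in>W. \<Psi> (z, x') \<le> \<Psi> (z, x)" for z
    by (intro continuous_attains_sup W(1,3) continuous_on_compose2[OF \<Psi>] continuous_intros) auto
  define h where "h z = (SUP x\<in>W. \<Psi> (z, x))" for z
  have att: "\<exists>x\<in>W. h z = \<Psi> (z, x) \<and> (\<forall>x'\<in>W. \<Psi> (z, x') \<le> h z)" for z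
  proof -
    obtain x where x: "x \<in> W" "\<forall>x'\<in>W. \<Psi> (z, x') \<le> \<Psi> (z, x)" using ex by blast
    then have "h z = \<Psi> (z, x)" unfolding h_def by (intro cSup_eq_maximum) auto
    with x show ?thesis by auto
  qed
  show thesis
  proof (rule that)
    show "continuous_on UNIV h"
      by (rule continuous_on_max_over_compact[OF W(1) \<Psi>]) (use att in blast)+
    show "u (x', y) - \<tau> * (norm (x - x'))\<^sup>2 \<le> h (x, y)" if "x' \<in> W" for x y x'
      using att[of "(x, y)"] that by (auto simp: \<Psi>_def)
    show "\<exists>x'\<in>W. h (x, y) = u (x', y) - \<tau> * (norm (x - x'))\<^sup>2" for x y
      using att[of "(x, y)"] by (auto simp: \<Psi>_def)
  qed
qed

lemma parallelogram_norm: "(norm (a + b))\<^sup>2 + (norm (a - b))\<^sup>2 = 2 * (norm a)\<^sup>2 + 2 * (norm b)\<^sup>2"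
  for a b :: "'a::real_inner"
  by (simp add: power2_norm_eq_inner inner_simps inner_commute)

text \<open>A maximiser \<open>x'\<close> for \<open>(x, y)\<close> is a competitor at both
  \<open>(x + a, y + b)\<close> and \<open>(x - a, y - b)\<close>. With \<open>x'\<close> frozen,
  the penalty in \<open>x\<close> and the term in \<open>y\<close> obey exact parallelogram
  identities.\<close>

lemma sup_convolution_semiconvex:
  fixes x a :: "'a::real_inner" and y b :: "'b::real_inner"
  assumes lower: "\<And>x y x'. x' \<in> W \<Longrightarrow> u (x', y) + \<sigma> * (norm y)\<^sup>2 - \<tau> * (norm (x - x'))\<^sup>2 \<le> h (x, y)"
    and attained: "\<And>x y. \<exists>x'\<in>W. h (x, y) = u (x', y) + \<sigma> * (norm y)\<^sup>2 - \<tau> * (norm (x - x'))\<^sup>2"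
    and convex: "\<And>x y b. x \<in> W \<Longrightarrow> 2 * u (x, y) \<le> u (x, y + b) + u (x, y - b)"
  shows "2 * h (x, y) \<le> h (x + a, y + b) + h (x - a, y - b) + 2 * \<tau> * (norm a)\<^sup>2 - 2 * \<sigma> * (norm b)\<^sup>2"
proof -
  obtain x' where x': "x' \<in> W" "h (x, y) = u (x', y) + \<sigma> * (norm y)\<^sup>2 - \<tau> * (norm (x - x'))\<^sup>2"
    using attained by blast
  have 1: "(norm (x + a - x'))\<^sup>2 + (norm (x - a - x'))\<^sup>2 = 2 * (norm (x - x'))\<^sup>2 + 2 * (norm a)\<^sup>2"
    using parallelogram_norm[of "x - x'" a] by (simp add: algebra_simps)
  have 2: "(norm (y + b))\<^sup>2 + (norm (y - b))\<^sup>2 = 2 * (norm y)\<^sup>2 + 2 * (norm b)\<^sup>2"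
    by (rule parallelogram_norm)
  have 3: "\<tau> * (norm (x + a - x'))\<^sup>2 + \<tau> * (norm (x - a - x'))\<^sup>2 = 2 * \<tau> * (norm (x - x'))\<^sup>2 + 2 * \<tau> * (norm a)\<^sup>2"
    using arg_cong[OF 1, of "(*) \<tau>"] by (simp add: distrib_left)
  have 4: "\<sigma> * (norm (y + b))\<^sup>2 + \<sigma> * (norm (y - b))\<^sup>2 = 2 * \<sigma> * (norm y)\<^sup>2 + 2 * \<sigma> * (norm b)\<^sup>2"
    using arg_cong[OF 2, of "(*) \<sigma>"] by (simp add: distrib_left)
  show ?thesis
    using lower[OF x'(1), of "y + b" "x + a"] lower[OF x'(1), of "y - b" "x - a"] convex[OF x'(1), of y b] x'(2) 3 4
    by linarith
qed

text \<open>The midpoint of maximisers for the two outer points is a competitor for the middle one.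
  If \<open>d\<close> is half their difference, the penalty yields a loss
  \<open>2 * \<tau> * (norm (a - d))\<^sup>2\<close>, which absorbs the excess of
  \<open>\<kappa> * (norm d)\<^sup>2\<close> over \<open>2 * \<kappa> * (norm a)\<^sup>2\<close>. So
  \<kappa> merely doubles, independently of \<tau>.\<close>

lemma sup_convolution_semiconcave:
  fixes x a :: "'a::real_inner" and y b :: "'b::real_inner"
  assumes lower: "\<And>x y x'. x' \<in> W \<Longrightarrow> v (x', y) - \<tau> * (norm (x - x'))\<^sup>2 \<le> h (x, y)"
    and attained: "\<And>x y. \<exists>x'\<in>W. h (x, y) = v (x', y) - \<tau> * (norm (x - x'))\<^sup>2"
    and W: "convex W" and \<kappa>: "0 \<le> \<kappa>" "\<kappa> \<le> \<tau>"
    and semi: "\<And>x a. \<lbrakk>x + a \<in> W; x - a \<in> W\<rbrakk> \<Longrightarrow> v (x + a, y + b) + v (x - a, y - b) \<le> 2 * v (x, y) + \<kappa> * ((norm a)\<^sup>2 + (norm b)\<^sup>2)"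
  shows "h (x + a, y + b) + h (x - a, y - b) \<le> 2 * h (x, y) + 2 * \<kappa> * ((norm a)\<^sup>2 + (norm b)\<^sup>2)"
proof -
  obtain x1 where x1: "x1 \<in> W" "h (x + a, y + b) = v (x1, y + b) - \<tau> * (norm (x + a - x1))\<^sup>2"
    using attained by blast
  obtain x2 where x2: "x2 \<in> W" "h (x - a, y - b) = v (x2, y - b) - \<tau> * (norm (x - a - x2))\<^sup>2"
    using attained by blast
  define m where "m = (1/2) *\<^sub>R (x1 + x2)"
  define d where "d = (1/2) *\<^sub>R (x1 - x2)"
  have eq: "x1 = m + d" "x2 = m - d"
    by (simp_all add: m_def d_def algebra_simps flip: scaleR_add_left)
  have m: "m \<in> W"
    using convexD[OF W x1(1) x2(1), of "1/2" "1/2"] by (simp add: m_def scaleR_add_right)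
  have 1: "v (x1, y + b) + v (x2, y - b) \<le> 2 * v (m, y) + \<kappa> * ((norm d)\<^sup>2 + (norm b)\<^sup>2)"
    using semi[of m d] x1(1) x2(1) by (simp add: eq)
  have "x + a - x1 = (x - m) + (a - d)" "x - a - x2 = (x - m) - (a - d)"
    by (simp_all add: eq algebra_simps)
  note split = this
  have 2: "\<tau> * (norm (x + a - x1))\<^sup>2 + \<tau> * (norm (x - a - x2))\<^sup>2 = 2 * (\<tau> * (norm (x - m))\<^sup>2) + 2 * (\<tau> * (norm (a - d))\<^sup>2)"
    unfolding split using arg_cong[OF parallelogram_norm[of "x - m" "a - d"], of "(*) \<tau>"] by (simp add: distrib_left)
  have cancel: "a - (a - d) = d" by simp
  have "(norm d)\<^sup>2 \<le> 2 * (norm a)\<^sup>2 + 2 * (norm (a - d))\<^sup>2"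
    using parallelogram_norm[of a "a - d", unfolded cancel] zero_le_power2[of "norm (a + (a - d))"] by linarith
  then have "\<kappa> * (norm d)\<^sup>2 \<le> 2 * \<kappa> * (norm a)\<^sup>2 + 2 * (\<kappa> * (norm (a - d))\<^sup>2)"
    using mult_left_mono[of "(norm d)\<^sup>2" "2 * (norm a)\<^sup>2 + 2 * (norm (a - d))\<^sup>2" \<kappa>] \<kappa> by (simp add: algebra_simps)
  moreover have "\<kappa> * (norm (a - d))\<^sup>2 \<le> \<tau> * (norm (a - d))\<^sup>2"
    using \<kappa> by (intro mult_right_mono) auto
  moreover have "0 \<le> \<kappa> * (norm b)\<^sup>2" using \<kappa> by simp
  moreover have "v (x1, y + b) + v (x2, y - b) \<le> 2 * v (m, y) + \<kappa> * (norm d)\<^sup>2 + \<kappa> * (norm b)\<^sup>2"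
    using 1 by (simp add: distrib_left)
  ultimately have "h (x + a, y + b) + h (x - a, y - b) \<le> 2 * h (x, y) + 2 * \<kappa> * (norm a)\<^sup>2 + 2 * (\<kappa> * (norm b)\<^sup>2)"
    using 2 lower[OF m, of y x] x1(2) x2(2) by linarith
  then show ?thesis by (simp add: distrib_left)
qed

section \<open>Peaks of marginals\<close>

text \<open>By continuity a good \<open>y\<close> for one point serves its neighbours, and finitely
  many suffice. Covering with half of the available radius leaves a uniform margin \<theta>, which
  lets the estimate survive the sup-convolution.\<close>

lemma sphere_uniformly_below:
  fixes u :: "'a::euclidean_space \<times> 'b::real_normed_vector \<Rightarrow> real"
  assumes cont: "continuous_on (W \<times> UNIV) u" and S: "compact S" "S \<subseteq> W"
    and below: "\<And>x. x \<in> S \<Longrightarrow> \<exists>y. u (x, y) < m"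
  obtains R \<theta> where "0 < R" "0 < \<theta>"
    and "\<And>x. x \<in> S \<Longrightarrow> \<exists>y. norm y \<le> R \<and> (\<forall>x'\<in>W. norm (x' - x) < \<theta> \<longrightarrow> u (x', y) < m)"
proof -
  have "\<exists>y r. 0 < r \<and> (\<forall>x'\<in>W. dist x' x < 2 * r \<longrightarrow> u (x', y) < m)" if x: "x \<in> S" for x
  proof -
    obtain y where y: "u (x, y) < m" using below x by blast
    have "continuous_on W (\<lambda>x. u (x, y))"
      by (intro continuous_on_compose2[OF cont] continuous_intros) auto
    then obtain d where d: "0 < d" "\<And>x'. x' \<in> W \<Longrightarrow> dist x' x < d \<Longrightarrow> dist (u (x', y)) (u (x, y)) < m - u (x, y)"
      using x S(2) y unfolding continuous_on_iff by (metis diff_gt_0_iff_gt subsetD)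
    then have "\<forall>x'\<in>W. dist x' x < 2 * (d / 2) \<longrightarrow> u (x', y) < m" by (auto simp: dist_real_def abs_less_iff)
    then show ?thesis using d(1) half_gt_zero by blast
  qed
  then obtain Y r where Y: "\<And>x. x \<in> S \<Longrightarrow> 0 < r x"
    "\<And>x x'. x \<in> S \<Longrightarrow> x' \<in> W \<Longrightarrow> dist x' x < 2 * r x \<Longrightarrow> u (x', Y x) < m"
    by metis
  obtain T where T: "T \<subseteq> S" "finite T" "S \<subseteq> (\<Union>x\<in>T. ball x (r x))"
  proof (rule compactE_image[OF S(1)])
    show "S \<subseteq> (\<Union>x\<in>S. ball x (r x))" using Y(1) by force
  qed auto
  define R where "R = 1 + (\<Sum>x\<in>T. norm (Y x))"
  \<comment> \<open>The inserted 1 keeps \<open>Min\<close> meaningful when \<open>T\<close> is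
    empty.\<close>
  define \<theta> where "\<theta> = Min (insert 1 (r ` T))"
  have \<theta>: "0 < \<theta>" "\<And>x. x \<in> T \<Longrightarrow> \<theta> \<le> r x"
    using T Y(1) by (auto simp: \<theta>_def subset_iff)
  have R: "0 < R" unfolding R_def by (intro add_pos_nonneg sum_nonneg) auto
  have RY: "norm (Y x) \<le> R" if "x \<in> T" for x
    using member_le_sum[of x T "\<lambda>x. norm (Y x)"] that T by (simp add: R_def)
  have "\<exists>y. norm y \<le> R \<and> (\<forall>x'\<in>W. norm (x' - x) < \<theta> \<longrightarrow> u (x', y) < m)" if x: "x \<in> S" for x
  proof -
    obtain t where t: "t \<in> T" "dist t x < r t" using T(3) x by auto
    have "u (x', Y t) < m" if "x' \<in> W" "norm (x' - x) < \<theta>" for x'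
    proof (rule Y(2))
      have "dist x' t \<le> dist x' x + dist t x" by (metis dist_commute dist_triangle)
      then show "dist x' t < 2 * r t" using that t \<theta>(2)[OF t(1)] by (simp add: dist_norm)
    qed (use t T that in auto)
    then show ?thesis using RY t by blast
  qed
  with R \<theta> show thesis using that by blast
qed

text \<open>Reduces to \<open>argmin_contact\<close>: the term in \<sigma> supplies strong convexity
  and confines the argmin, the sup-convolution supplies semiconvexity in \<open>x\<close>, and for
  large \<tau> it moves points so little that half of the peak survives.\<close>

proposition marginal_peak_contact:
  fixes u :: "'a::euclidean_space \<times> 'b::euclidean_space \<Rightarrow> real"
  assumes \<rho>: "0 < \<rho>" and cont: "continuous_on (cball 0 \<rho> \<times> UNIV) u"
    and convex: "\<And>x y b. x \<in> cball 0 \<rho> \<Longrightarrow> 2 * u (x, y) \<le> u (x, y + b) + u (x, y - b)"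
    and concave: "\<And>R. \<exists>\<kappa>\<ge>0. \<forall>x y a b. x + a \<in> cball 0 \<rho> \<longrightarrow> x - a \<in> cball 0 \<rho> \<longrightarrow>
      y + b \<in> cball 0 R \<longrightarrow> y - b \<in> cball 0 R \<longrightarrow>
      u (x + a, y + b) + u (x - a, y - b) \<le> 2 * u (x, y) + \<kappa> * ((norm a)\<^sup>2 + (norm b)\<^sup>2)"
    and bdd: "\<And>x y. x \<in> cball 0 \<rho> \<Longrightarrow> c \<le> u (x, y)"
    and \<mu>: "0 < \<mu>" and low: "\<And>y. m \<le> u (0, y)"
    and peak: "\<And>x. norm x = \<rho> / 2 \<Longrightarrow> \<exists>y. u (x, y) < m - \<mu>"
  obtains x y p\<^sub>1 p\<^sub>2 \<Gamma> K d where "x \<in> ball 0 \<rho>" "linear \<Gamma>" "0 < d"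
    and "\<And>s t. \<lbrakk>norm s < d; norm t < d\<rbrakk> \<Longrightarrow>
      u (x + s, y + t) \<le> u (x, y) + p\<^sub>1 \<bullet> s + p\<^sub>2 \<bullet> t + K * (norm (t - \<Gamma> s))\<^sup>2"
proof -
  define W where "W = cball (0::'a) \<rho>"
  have W: "compact W" "convex W" "W \<noteq> {}" "0 \<in> W" using \<rho> by (auto simp: W_def)
  note cont = cont[folded W_def] and convex = convex[folded W_def] and concave = concave[folded W_def]
    and bdd = bdd[folded W_def]
  obtain R1 \<theta>0 where R1: "0 < R1" "0 < \<theta>0"
    and Y: "\<And>x. x \<in> sphere 0 (\<rho>/2) \<Longrightarrow> \<exists>y. norm y \<le> R1 \<and> (\<forall>x'\<in>W. norm (x' - x) < \<theta>0 \<longrightarrow> u (x', y) < m - \<mu>)"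
  proof (rule sphere_uniformly_below[OF cont compact_sphere])
    show "sphere 0 (\<rho> / 2) \<subseteq> W" using \<rho> by (auto simp: W_def)
    show "\<exists>y. u (x, y) < m - \<mu>" if "x \<in> sphere 0 (\<rho> / 2)" for x using peak that by simp
  qed blast
  define \<theta> where "\<theta> = min \<theta>0 (\<rho> / 2)"
  have \<theta>: "0 < \<theta>" "\<theta> \<le> \<theta>0" "\<theta> \<le> \<rho> / 2" using R1 \<rho> by (auto simp: \<theta>_def)
  \<comment> \<open>On the ball of radius \<open>R1\<close>, where the low values over the sphere
    are found, the added term costs at most half of the peak.\<close>
  define \<sigma> where "\<sigma> = \<mu> / (2 * R1\<^sup>2)"
  have \<sigma>: "0 < \<sigma>" "\<sigma> * R1\<^sup>2 = \<mu> / 2" using \<mu> R1 by (auto simp: \<sigma>_def)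
  define v where "v z = u z + \<sigma> * (norm (snd z))\<^sup>2" for z
  have v_cont: "continuous_on (W \<times> UNIV) v"
    unfolding v_def by (intro continuous_intros cont)
  have "continuous_on W (\<lambda>x. u (x, 0))"
    by (intro continuous_on_compose2[OF cont] continuous_intros) auto
  then obtain M0 where M0: "\<And>x. x \<in> W \<Longrightarrow> u (x, 0) \<le> M0"
    using continuous_attains_sup[OF W(1,3)] by metis
  \<comment> \<open>Beyond radius \<open>R\<close> the term in \<sigma> outweighs the gap between
    the lower bound \<open>c\<close> and the upper bound \<open>M0\<close> at \<open>y = 0\<close>,
    so argmins of the convolution lie within \<open>R\<close>.\<close>
  define R where "R = max R1 (sqrt ((M0 - c + 1) / \<sigma>))"
  have "c \<le> M0" using bdd[OF W(4), of 0] M0[OF W(4)] by linarith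
  then have R: "R1 \<le> R" "M0 - c + 1 \<le> \<sigma> * R\<^sup>2" "0 < R"
  proof -
    show "R1 \<le> R" by (simp add: R_def)
    then show "0 < R" using R1 by simp
    have "(M0 - c + 1) / \<sigma> = (sqrt ((M0 - c + 1) / \<sigma>))\<^sup>2" using \<open>c \<le> M0\<close> \<sigma> by simp
    also have "\<dots> \<le> R\<^sup>2" using \<open>c \<le> M0\<close> \<sigma> by (intro power_mono) (auto simp: R_def)
    finally show "M0 - c + 1 \<le> \<sigma> * R\<^sup>2" using \<sigma> by (simp add: field_simps)
  qed
  obtain \<kappa>0 where \<kappa>0: "0 \<le> \<kappa>0" and u_concave: "\<And>x y a b. \<lbrakk>x + a \<in> W; x - a \<in> W; y + b \<in> cball 0 (R + 1); y - b \<in> cball 0 (R + 1)\<rbrakk> \<Longrightarrow>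
      u (x + a, y + b) + u (x - a, y - b) \<le> 2 * u (x, y) + \<kappa>0 * ((norm a)\<^sup>2 + (norm b)\<^sup>2)"
    using concave[of "R + 1"] by metis
  define \<kappa> where "\<kappa> = \<kappa>0 + 2 * \<sigma>"
  have \<kappa>: "0 \<le> \<kappa>" using \<kappa>0 \<sigma> by (simp add: \<kappa>_def)
  have v_concave: "v (x + a, y + b) + v (x - a, y - b) \<le> 2 * v (x, y) + \<kappa> * ((norm a)\<^sup>2 + (norm b)\<^sup>2)"
    if "x + a \<in> W" "x - a \<in> W" "y + b \<in> cball 0 (R + 1)" "y - b \<in> cball 0 (R + 1)" for x y a b
  proof -
    have "\<sigma> * (norm (y + b))\<^sup>2 + \<sigma> * (norm (y - b))\<^sup>2 = 2 * (\<sigma> * (norm y)\<^sup>2) + 2 * (\<sigma> * (norm b)\<^sup>2)"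
      using arg_cong[OF parallelogram_norm[of y b], of "(*) \<sigma>"] by (simp add: distrib_left)
    moreover have "0 \<le> \<sigma> * (norm a)\<^sup>2" using \<sigma> by simp
    ultimately show ?thesis
      using u_concave[OF that] by (simp add: v_def \<kappa>_def algebra_simps)
  qed
  have "compact (W \<times> cball (0::'b) (R + 1))" using W by (intro compact_Times) auto
  moreover have "continuous_on (W \<times> cball 0 (R + 1)) v" by (rule continuous_on_subset[OF v_cont]) auto
  ultimately have "bounded (v ` (W \<times> cball 0 (R + 1)))"
    by (intro compact_imp_bounded compact_continuous_image)
  then obtain M where "\<And>z. z \<in> W \<times> cball 0 (R + 1) \<Longrightarrow> \<bar>v z\<bar> \<le> M"
    unfolding bounded_iff by auto
  then have M: "\<bar>v (x, y)\<bar> \<le> M" if "x \<in> W" "norm y \<le> R + 1" for x y using that by auto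
  \<comment> \<open>A competitor at distance at least \<theta> pays at least \<open>B\<close>, which
    pushes it below both the range of \<open>v\<close> on the relevant compact set and the level
    needed for the peak. The summand \<kappa> in \<tau> ensures
    \<open>\<kappa> \<le> \<tau>\<close>; \<kappa>, \<open>M\<close> and \<theta> are fixed before
    \<tau>.\<close>
  define B where "B = 2 * \<bar>M\<bar> + \<bar>m\<bar> + \<mu> + 1"
  define \<tau> where "\<tau> = \<kappa> + B / \<theta>\<^sup>2"
  have "0 \<le> B / \<theta>\<^sup>2" using \<mu> by (simp add: B_def)
  then have \<tau>: "\<kappa> \<le> \<tau>" "0 \<le> \<tau>" using \<kappa> by (auto simp: \<tau>_def)
  have "\<tau> * \<theta>\<^sup>2 = \<kappa> * \<theta>\<^sup>2 + B" using \<theta> by (simp add: \<tau>_def distrib_right)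
  then have \<tau>\<theta>: "2 * \<bar>M\<bar> + \<bar>m\<bar> + \<mu> + 1 \<le> \<tau> * \<theta>\<^sup>2" using \<kappa> by (simp add: B_def)
  obtain h where h_cont: "continuous_on UNIV h"
    and lower: "\<And>x y x'. x' \<in> W \<Longrightarrow> v (x', y) - \<tau> * (norm (x - x'))\<^sup>2 \<le> h (x, y)"
    and attained: "\<And>x y. \<exists>x'\<in>W. h (x, y) = v (x', y) - \<tau> * (norm (x - x'))\<^sup>2"
    using partial_sup_convolution[OF W(1,2,3) v_cont] by metis
  have h_convex: "2 * h (x, y) \<le> h (x + a, y + b) + h (x - a, y - b) + 2 * \<tau> * (norm a)\<^sup>2 - 2 * \<sigma> * (norm b)\<^sup>2" for x y a b
    using sup_convolution_semiconvex[where u = u and W = W and h = h and \<tau> = \<tau> and \<sigma> = \<sigma>] lower attained convex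
    by (simp add: v_def)
  have h_concave: "h (x + a, y + b) + h (x - a, y - b) \<le> 2 * h (x, y) + 2 * \<kappa> * ((norm a)\<^sup>2 + (norm b)\<^sup>2)"
    if "y + b \<in> cball 0 (R + 1)" "y - b \<in> cball 0 (R + 1)" for x y a b
    using sup_convolution_semiconcave[OF lower attained W(2) \<kappa> \<tau>(1) v_concave] that by blast
  have far: "v (x', y) - \<tau> * (norm (x - x'))\<^sup>2 \<le> - M - \<bar>m\<bar> - \<mu> - 1"
    if "x' \<in> W" "norm y \<le> R + 1" "\<theta> \<le> norm (x - x')" for x x' y
  proof -
    have "\<tau> * \<theta>\<^sup>2 \<le> \<tau> * (norm (x - x'))\<^sup>2" using that \<theta> \<tau> by (intro mult_left_mono power_mono) auto
    then show ?thesis using \<tau>\<theta> M[OF that(1,2)] by linarith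
  qed
  have argmin_ex: "\<exists>y\<in>cball 0 R. \<forall>y'. h (x, y) \<le> h (x, y')" if x: "x \<in> W" for x
  proof -
    have "continuous_on (cball 0 R) (\<lambda>y. h (x, y))"
      by (intro continuous_on_compose2[OF h_cont] continuous_intros) auto
    then obtain y where y: "y \<in> cball 0 R" "\<And>y'. y' \<in> cball 0 R \<Longrightarrow> h (x, y) \<le> h (x, y')"
      using continuous_attains_inf[of "cball 0 R" "\<lambda>y. h (x, y)"] R by auto
    have "h (x, y) \<le> h (x, y')" if "y' \<notin> cball 0 R" for y'
    proof -
      have "h (x, y) \<le> h (x, 0)" using y(2)[of 0] R by simp
      also have "h (x, 0) \<le> M0"
      proof -
        obtain x' where x': "x' \<in> W" "h (x, 0) = v (x', 0) - \<tau> * (norm (x - x'))\<^sup>2" using attained by blast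
        have "0 \<le> \<tau> * (norm (x - x'))\<^sup>2" using \<tau>(2) by simp
        then show ?thesis using M0[OF x'(1)] x'(2) by (simp add: v_def)
      qed
      also have "M0 \<le> c + \<sigma> * R\<^sup>2" using R(2) by simp
      also have "\<dots> \<le> u (x, y') + \<sigma> * (norm y')\<^sup>2"
        using bdd[OF x] that R \<sigma> by (intro add_mono mult_left_mono power_mono) auto
      also have "\<dots> \<le> h (x, y')" using lower[OF x, of y' x] by (simp add: v_def)
      finally show ?thesis .
    qed
    with y show ?thesis by blast
  qed
  have half: "cball 0 (\<rho> / 2) \<subseteq> W" using \<rho> by (auto simp: W_def)
  then obtain \<gamma> where \<gamma>: "\<And>x. x \<in> cball 0 (\<rho> / 2) \<Longrightarrow> \<gamma> x \<in> cball 0 R"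
    and argmin: "\<And>x y. x \<in> cball 0 (\<rho> / 2) \<Longrightarrow> h (x, \<gamma> x) \<le> h (x, y)"
    using argmin_ex by (metis subsetD)
  have h_peak: "h (x, \<gamma> x) \<le> h (0, \<gamma> 0) - \<mu> / 2" if x: "norm x = \<rho> / 2" for x
  proof -
    obtain y where y: "norm y \<le> R1" "\<And>x'. x' \<in> W \<Longrightarrow> norm (x' - x) < \<theta>0 \<Longrightarrow> u (x', y) < m - \<mu>"
      using Y[of x] x by auto
    obtain x' where x': "x' \<in> W" "h (x, y) = v (x', y) - \<tau> * (norm (x - x'))\<^sup>2" using attained by blast
    have "h (x, y) \<le> m - \<mu> / 2"
    proof (cases "norm (x - x') < \<theta>")
      case True
      then have "u (x', y) < m - \<mu>" using y(2)[OF x'(1)] \<theta> by (simp add: norm_minus_commute)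
      moreover have "\<sigma> * (norm y)\<^sup>2 \<le> \<sigma> * R1\<^sup>2" using y(1) \<sigma> by (intro mult_left_mono power_mono) auto
      moreover have "0 \<le> \<tau> * (norm (x - x'))\<^sup>2" using \<tau> by simp
      ultimately show ?thesis using x'(2) \<sigma> by (simp add: v_def)
    next
      case False
      have "\<bar>v (0, 0)\<bar> \<le> M" using M[OF W(4), of 0] R by simp
      then have "0 \<le> M" by linarith
      then show ?thesis using far[OF x'(1), of y x] False y(1) R(1) x'(2) \<mu> by simp
    qed
    moreover have "m \<le> h (0, \<gamma> 0)"
    proof -
      have "0 \<le> \<sigma> * (norm (\<gamma> 0))\<^sup>2" using \<sigma>(1) by simp
      then show ?thesis using low[of "\<gamma> 0"] lower[OF W(4), of "\<gamma> 0" 0] by (simp add: v_def)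
    qed
    moreover have "h (x, \<gamma> x) \<le> h (x, y)" using argmin x by simp
    ultimately show ?thesis by linarith
  qed
  have r: "0 < \<rho> / 2" and \<mu>2: "0 < \<mu> / 2" using \<rho> \<mu> by simp_all
  obtain x y p\<^sub>1 p\<^sub>2 \<Gamma> K d where xy: "x \<in> ball 0 (\<rho> / 2)" "y \<in> cball 0 (R + 1)" "linear \<Gamma>" "0 < d"
    and contact: "\<And>s t. \<lbrakk>norm s < d; norm t < d\<rbrakk> \<Longrightarrow>
      h (x + s, y + t) \<le> h (x, y) + p\<^sub>1 \<bullet> s + p\<^sub>2 \<bullet> t + K * (norm (t - \<Gamma> s))\<^sup>2 + \<sigma> * (norm t)\<^sup>2"
    using argmin_contact[OF r \<sigma>(1) \<tau>(2) \<kappa> \<mu>2 h_cont h_convex h_concave \<gamma> argmin h_peak] by metis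
  have "x \<in> W" using xy half by auto
  obtain x' where x': "x' \<in> W" "h (x, y) = v (x', y) - \<tau> * (norm (x - x'))\<^sup>2" using attained by blast
  have close: "norm (x - x') < \<theta>"
  proof (rule ccontr)
    assume "\<not> norm (x - x') < \<theta>"
    then have "h (x, y) \<le> - M - \<bar>m\<bar> - \<mu> - 1" using far[OF x'(1), of y x] xy(2) x'(2) by simp
    moreover have "- M \<le> h (x, y)" using lower[OF \<open>x \<in> W\<close>, of y x] M[OF \<open>x \<in> W\<close>, of y] xy(2) by simp
    ultimately show False using \<mu> by linarith
  qed
  have x'_ball: "x' \<in> ball 0 \<rho>"
    using norm_triangle_ineq4[of x "x - x'"] close \<theta>(3) xy(1) by simp
  show thesis
  \<comment> \<open>Moving \<open>x\<close> and \<open>x'\<close> by the same \<open>s\<close>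
    leaves the penalty unchanged, so contact of \<open>h\<close> at \<open>(x, y)\<close> becomes
    contact of \<open>v\<close> at \<open>(x', y)\<close>. Removing the term in \<sigma> shifts the
    slope by \<open>(2 * \<sigma>) *\<^sub>R y\<close> and cancels
    \<open>\<sigma> * (norm t)\<^sup>2\<close>.\<close>
  proof (rule that[of x' \<Gamma> "min d (\<rho> - norm x')" y p\<^sub>1 "p\<^sub>2 - (2 * \<sigma>) *\<^sub>R y" K])
    fix s :: 'a and t :: 'b
    assume s: "norm s < min d (\<rho> - norm x')" and t: "norm t < min d (\<rho> - norm x')"
    have "x' + s \<in> W" using norm_triangle_ineq[of x' s] s by (simp add: W_def)
    from lower[OF this, of "y + t" "x + s"]
    have "v (x' + s, y + t) - \<tau> * (norm (x - x'))\<^sup>2 \<le> h (x + s, y + t)" by simp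
    moreover have "(norm (y + t))\<^sup>2 = (norm y)\<^sup>2 + 2 * (y \<bullet> t) + (norm t)\<^sup>2"
      by (simp add: power2_norm_eq_inner inner_simps inner_commute)
    then have "\<sigma> * (norm (y + t))\<^sup>2 = \<sigma> * (norm y)\<^sup>2 + (2 * \<sigma>) * (y \<bullet> t) + \<sigma> * (norm t)\<^sup>2"
      by (simp add: algebra_simps)
    ultimately show "u (x' + s, y + t) \<le> u (x', y) + p\<^sub>1 \<bullet> s + (p\<^sub>2 - (2 * \<sigma>) *\<^sub>R y) \<bullet> t + K * (norm (t - \<Gamma> s))\<^sup>2"
      using contact[of s t] s t x'(2) by (simp add: v_def inner_diff_left)
  qed (use x'_ball xy in auto)
qed

section \<open>Jets of product-subharmonic functions\<close>

lemma locally_semiconcave_imp_continuous_on: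
  fixes f :: "'a::euclidean_space \<Rightarrow> real"
  assumes "locally_semiconcave_on S f"
  shows "continuous_on S f"
proof (rule continuous_at_imp_continuous_on, rule ballI)
  fix z assume "z \<in> S"
  then obtain r \<kappa> where r: "0 < r" and conc: "concave_on (ball z r) (\<lambda>w. f w - (\<kappa> / 2) * (norm w)\<^sup>2)"
    using assms unfolding locally_semiconcave_on_def semiconcave_on_def by blast
  have "continuous_on (ball z r) (\<lambda>w. - (f w - (\<kappa> / 2) * (norm w)\<^sup>2))"
    using conc unfolding concave_on_def by (intro convex_on_continuous) auto
  moreover have "continuous_on (ball z r) (\<lambda>w. (\<kappa> / 2) * (norm w)\<^sup>2)" by (intro continuous_intros)
  ultimately have "continuous_on (ball z r) (\<lambda>w. (\<kappa> / 2) * (norm w)\<^sup>2 - (- (f w - (\<kappa> / 2) * (norm w)\<^sup>2)))"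
    by (rule continuous_on_diff[rotated])
  then have "continuous_on (ball z r) f" by simp
  then show "isCont f z" using r by (simp add: continuous_on_eq_continuous_at)
qed

lemma semiconcave_on_midpoint:
  fixes h :: "'a::real_inner \<Rightarrow> real"
  assumes "semiconcave_on \<kappa> S h" "z + v \<in> S" "z - v \<in> S"
  shows "h (z + v) + h (z - v) \<le> 2 * h z + \<kappa> * (norm v)\<^sup>2"
proof -
  have conc: "concave_on S (\<lambda>z. h z - (\<kappa> / 2) * (norm z)\<^sup>2)"
    using assms(1) by (simp add: semiconcave_on_def)
  have "(1 - 1/2) *\<^sub>R (z + v) + (1/2) *\<^sub>R (z - v) = z"
    by (simp add: algebra_simps flip: scaleR_add_left)
  then have "(1/2) * (h (z + v) - (\<kappa> / 2) * (norm (z + v))\<^sup>2) + (1/2) * (h (z - v) - (\<kappa> / 2) * (norm (z - v))\<^sup>2)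
      \<le> h z - (\<kappa> / 2) * (norm z)\<^sup>2"
    using concave_onD[OF conc _ _ assms(2,3), of "1/2"] by simp
  moreover have "(\<kappa> / 2) * (norm (z + v))\<^sup>2 + (\<kappa> / 2) * (norm (z - v))\<^sup>2 = \<kappa> * (norm z)\<^sup>2 + \<kappa> * (norm v)\<^sup>2"
    by (simp add: power2_norm_eq_inner inner_simps inner_commute algebra_simps)
  ultimately show ?thesis by (simp add: algebra_simps)
qed

text \<open>Below a Lebesgue number \<open>e\<close> of a finite cover, all three points lie in one
  ball and its constant applies; for longer \<open>v\<close> the crude bound
  \<open>4 * \<bar>M\<bar>\<close> is at most \<open>4 * \<bar>M\<bar> / e\<^sup>2\<close> times
  \<open>(norm v)\<^sup>2\<close>.\<close>

lemma locally_semiconcave_imp_midpoint_on_compact: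
  fixes f :: "'a::euclidean_space \<Rightarrow> real"
  assumes f: "locally_semiconcave_on S f" and K: "compact K" "convex K" "K \<subseteq> S"
  obtains \<kappa> where "0 \<le> \<kappa>"
    and "\<And>z v. \<lbrakk>z + v \<in> K; z - v \<in> K\<rbrakk> \<Longrightarrow> f (z + v) + f (z - v) \<le> 2 * f z + \<kappa> * (norm v)\<^sup>2"
proof -
  obtain r k where rk: "\<And>z. z \<in> S \<Longrightarrow> 0 < r z" "\<And>z. z \<in> S \<Longrightarrow> semiconcave_on (k z) (ball z (r z)) f"
    using f unfolding locally_semiconcave_on_def by metis
  obtain T where T: "T \<subseteq> K" "finite T" "K \<subseteq> (\<Union>z\<in>T. ball z (r z))"
  proof (rule compactE_image[OF K(1)])
    show "K \<subseteq> (\<Union>z\<in>K. ball z (r z))" using rk(1) K(3) by force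
  qed auto
  obtain e where e: "0 < e" "\<And>z. z \<in> K \<Longrightarrow> \<exists>G\<in>(\<lambda>z. ball z (r z)) ` T. ball z e \<subseteq> G"
    using Heine_Borel_lemma[OF K(1), of "(\<lambda>z. ball z (r z)) ` T"] T(3) by (metis (no_types, lifting) image_iff open_ball)
  have "bounded (f ` K)"
    using K by (intro compact_imp_bounded compact_continuous_image
        continuous_on_subset[OF locally_semiconcave_imp_continuous_on[OF f]])
  then obtain M where M: "\<And>z. z \<in> K \<Longrightarrow> \<bar>f z\<bar> \<le> M" by (auto simp: bounded_iff)
  define \<kappa> where "\<kappa> = (\<Sum>z\<in>T. k z) + 4 * \<bar>M\<bar> / e\<^sup>2"
  have k: "0 \<le> k z" if "z \<in> T" for z
    using rk(2)[of z] that T(1) K(3) by (auto simp: semiconcave_on_def)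
  have "0 \<le> (\<Sum>z\<in>T. k z)" using k by (rule sum_nonneg)
  moreover have "0 \<le> 4 * \<bar>M\<bar> / e\<^sup>2" by simp
  ultimately have \<kappa>: "0 \<le> \<kappa>" "4 * \<bar>M\<bar> / e\<^sup>2 \<le> \<kappa>" by (auto simp: \<kappa>_def)
  have "f (z + v) + f (z - v) \<le> 2 * f z + \<kappa> * (norm v)\<^sup>2" if zv: "z + v \<in> K" "z - v \<in> K" for z v
  proof -
    have "(1/2) *\<^sub>R (z + v) + (1/2) *\<^sub>R (z - v) = z"
      by (simp add: algebra_simps flip: scaleR_add_left)
    then have z: "z \<in> K" using convexD[OF K(2) zv, of "1/2" "1/2"] by simp
    show ?thesis
    proof (cases "norm v < e")
      case True
      obtain t where t: "t \<in> T" "ball z e \<subseteq> ball t (r t)" using e(2)[OF z] by blast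
      have "z + v \<in> ball z e" "z - v \<in> ball z e" using True by (simp_all add: dist_norm)
      then have "f (z + v) + f (z - v) \<le> 2 * f z + k t * (norm v)\<^sup>2"
        using t T(1) K(3) rk(2)[of t] by (intro semiconcave_on_midpoint) auto
      moreover have "k t \<le> (\<Sum>z\<in>T. k z)" using t T(2) k by (intro member_le_sum) auto
      then have "k t \<le> \<kappa>" using \<open>0 \<le> 4 * \<bar>M\<bar> / e\<^sup>2\<close> unfolding \<kappa>_def by linarith
      then have "k t * (norm v)\<^sup>2 \<le> \<kappa> * (norm v)\<^sup>2" by (intro mult_right_mono) auto
      ultimately show ?thesis by linarith
    next
      case False
      have "4 * \<bar>M\<bar> = (4 * \<bar>M\<bar> / e\<^sup>2) * e\<^sup>2" using e(1) by simp
      also have "\<dots> \<le> \<kappa> * (norm v)\<^sup>2"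
        using \<kappa> False e(1) by (intro mult_mono power_mono) auto
      finally show ?thesis using M[OF zv(1)] M[OF zv(2)] M[OF z] by linarith
    qed
  qed
  with \<kappa>(1) show thesis by (rule that)
qed

section \<open>From contact estimates to membership of jets\<close>

lemma upper_contact_prodI:
  assumes "0 < d" and "\<And>s t. \<lbrakk>norm s < d; norm t < d\<rbrakk> \<Longrightarrow>
    u (x + s, y + t) \<le> u (x, y) + p1 \<bullet> s + p2 \<bullet> t + (1/2) * (s \<bullet> (B *v s) + 2 * (s \<bullet> (C *v t)) + t \<bullet> (D *v t))"
  shows "upper_contact_prod u x y p1 p2 B C D"
  unfolding upper_contact_prod_def
proof (intro exI conjI allI impI)
  fix z w assume "(z, w) \<in> ball (x, y) d"
  then have "dist (x, y) (z, w) < d" by simp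
  then have "norm (z - x) < d" "norm (w - y) < d"
    using dist_fst_le[of "(x, y)" "(z, w)"] dist_snd_le[of "(x, y)" "(z, w)"]
    by (auto simp: dist_norm norm_minus_commute)
  from assms(2)[OF this]
  show "u (z, w) \<le> u (x, y) + p1 \<bullet> (z - x) + p2 \<bullet> (w - y) + (1/2) * ((z - x) \<bullet> (B *v (z - x))
      + 2 * ((z - x) \<bullet> (C *v (w - y))) + (w - y) \<bullet> (D *v (w - y)))"
    by simp
qed (rule assms(1))

lemma scaleR_mat_1_mult_vec [simp]: "(c *\<^sub>R mat 1) *v v = c *\<^sub>R v" for v :: "real^'n"
  by (simp add: scaleR_matrix_vector_assoc[symmetric])

lemma transpose_plus: "transpose (A + B) = transpose A + transpose B" for A B :: "real^'n^'m"
  by (simp add: transpose_def vec_eq_iff)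

text \<open>The blocks \<open>B\<close>, \<open>C\<close>, \<open>D\<close> come from expanding
  \<open>K * (norm (t - \<Gamma> s))\<^sup>2\<close>. This square vanishes on the graph of \<Gamma>,
  so pulling the jet back along \<Gamma> returns exactly \<open>A\<close>; only the gradient
  changes.\<close>

lemma sharp_P_subharmonic_marginal_contact:
  fixes f :: "(real^'n) \<times> (real^'m) \<Rightarrow> real"
  assumes f: "sharp_P_subharmonic X F f" and x: "x \<in> X" and A: "sym_mat A" and \<Gamma>: "linear \<Gamma>" and d: "0 < d"
    and contact: "\<And>s t. \<lbrakk>norm s < d; norm t < d\<rbrakk> \<Longrightarrow>
      f (x + s, y + t) \<le> f (x, y) + p1 \<bullet> s + p2 \<bullet> t + (1/2) * (s \<bullet> (A *v s)) + K * (norm (t - \<Gamma> s))\<^sup>2"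
  shows "\<exists>p. (x, f (x, y), p, A) \<in> F"
proof -
  define G where "G = matrix \<Gamma>"
  have G: "\<Gamma> s = G *v s" for s using \<Gamma> by (simp add: G_def)
  define H where "H = transpose G ** G"
  define B where "B = A + (2 * K) *\<^sub>R H"
  define C where "C = (- (2 * K)) *\<^sub>R transpose G"
  define D where "D = (2 * K) *\<^sub>R (mat 1 :: real^'m^'m)"
  have "transpose H = H" by (simp add: H_def matrix_transpose_mul)
  then have "sym_mat B" using A by (simp add: sym_mat_def B_def transpose_plus transpose_scalar)
  moreover have "sym_mat D" by (simp add: sym_mat_def D_def transpose_scalar)
  moreover have "upper_contact_prod f x y p1 p2 B C D"
  proof (rule upper_contact_prodI[OF d])
    fix s :: "real^'n" and t :: "real^'m" assume st: "norm s < d" "norm t < d"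
    have 1: "s \<bullet> (w v* G) = (G *v s) \<bullet> w" for w
      by (metis dot_lmul_matrix inner_commute)
    have "s \<bullet> (H *v s) = (G *v s) \<bullet> (G *v s)"
      by (simp add: H_def matrix_vector_mul_assoc[symmetric] 1)
    moreover have "C *v t = (- (2 * K)) *\<^sub>R (t v* G)"
      unfolding C_def scaleR_matrix_vector_assoc[symmetric] by simp
    ultimately have "(1/2) * (s \<bullet> (B *v s) + 2 * (s \<bullet> (C *v t)) + t \<bullet> (D *v t))
        = (1/2) * (s \<bullet> (A *v s)) + K * (norm (t - \<Gamma> s))\<^sup>2"
      by (simp add: B_def D_def 1 G power2_norm_eq_inner inner_simps inner_commute
          matrix_vector_mult_add_rdistrib scaleR_matrix_vector_assoc[symmetric] algebra_simps)
    then show "f (x + s, y + t) \<le> f (x, y) + p1 \<bullet> s + p2 \<bullet> t + (1/2) * (s \<bullet> (B *v s) + 2 * (s \<bullet> (C *v t)) + t \<bullet> (D *v t))"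
      using contact[OF st] by linarith
  qed
  ultimately have "in_sharp_P F x (f (x, y)) p1 p2 B C D"
    using f x by (simp add: sharp_P_subharmonic_def)
  then have "(x, f (x, y), p1 + transpose G *v p2,
      B + C ** G + transpose G ** transpose C + transpose G ** D ** G) \<in> F"
    by (simp add: in_sharp_P_def)
  moreover have "B + C ** G + transpose G ** transpose C + transpose G ** D ** G = A"
  proof -
    have "C ** G = (- (2 * K)) *\<^sub>R H" "transpose G ** transpose C = (- (2 * K)) *\<^sub>R H"
      "transpose G ** D ** G = (2 * K) *\<^sub>R H"
      unfolding C_def D_def H_def transpose_scalar transpose_transpose matrix_scalar_ac
        scalar_matrix_assoc[symmetric] matrix_mul_rid by (rule refl)+
    then show ?thesis by (simp add: B_def)
  qed
  ultimately show ?thesis by auto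
qed

lemma outer_product_mult_vec: "(\<chi> i j. e $ i * e $ j) *v t = (e \<bullet> t) *\<^sub>R e" for e t :: "real^'n"
  by (simp add: vec_eq_iff matrix_vector_mult_def inner_vec_def sum_distrib_left mult_ac)

text \<open>Restriction to a slice: a failure of convexity of \<open>f (x, _)\<close> in direction \<open>e\<close> is turned into an
  upper contact point nearby by penalising \<open>x\<close> and the directions orthogonal to \<open>e\<close>.\<close>

lemma sharp_P_subharmonic_slice_convex:
  fixes f :: "(real^'n) \<times> (real^'m) \<Rightarrow> real"
  assumes X: "open X" and f: "sharp_P_subharmonic X F f" and cont: "continuous_on (X \<times> UNIV) f" and x: "x \<in> X"
  shows "2 * f (x, y) \<le> f (x, y + b) + f (x, y - b)"
proof (rule ccontr)
  assume contra: "\<not> 2 * f (x, y) \<le> f (x, y + b) + f (x, y - b)"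
  define a where "a = (f (x, y + b) + f (x, y - b)) / 2"
  define \<eta> where "\<eta> = (f (x, y) - a) / 4"
  have \<eta>: "0 < \<eta>" "f (x, y) = a + 4 * \<eta>" using contra by (auto simp: \<eta>_def a_def field_simps)
  have "b \<noteq> 0" using contra by auto
  define \<beta> where "\<beta> = norm b"
  define e where "e = (1 / \<beta>) *\<^sub>R b"
  have \<beta>: "0 < \<beta>" using \<open>b \<noteq> 0\<close> by (simp add: \<beta>_def)
  have b: "b = \<beta> *\<^sub>R e" using \<beta> by (simp add: e_def)
  have "norm e = 1" using \<beta> by (simp add: e_def \<beta>_def)
  then have ee: "e \<bullet> e = 1" by (simp add: norm_eq_1)
  \<comment> \<open>Subtracting the slope along \<open>b\<close> gives \<psi> the same value
    \<open>a\<close> at both ends, while it is \<open>a + 4 * \<eta>\<close> in the middle.\<close>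
  define l where "l = ((f (x, y + b) - f (x, y - b)) / (2 * \<beta>)) *\<^sub>R e"
  have lb: "l \<bullet> b = (f (x, y + b) - f (x, y - b)) / 2" using \<beta> by (simp add: l_def b ee)
  define \<psi> where "\<psi> p = f (x + fst p, y + snd p) - l \<bullet> snd p" for p
  obtain r where r: "0 < r" "cball x r \<subseteq> X" using X x open_contains_cball by metis
  have \<psi>_cont: "continuous_on (cball 0 r \<times> UNIV) \<psi>"
    unfolding \<psi>_def
  proof (intro continuous_intros continuous_on_compose2[OF cont])
    show "(\<lambda>p. (x + fst p, y + snd p)) ` (cball 0 r \<times> UNIV) \<subseteq> X \<times> UNIV"
      using r(2) by (force simp: subset_iff dist_norm)
  qed
  have \<psi>_at: "\<psi> (0, 0) = a + 4 * \<eta>" "\<psi> (0, b) = a" "\<psi> (0, - b) = a"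
    using \<eta> lb by (auto simp: \<psi>_def a_def field_simps)
  have near: "\<exists>d>0. \<forall>p\<in>cball 0 r \<times> UNIV. dist p (0, t) < d \<longrightarrow> \<psi> p \<le> \<psi> (0, t) + \<eta>" for t
  proof -
    have "(0, t) \<in> cball 0 r \<times> UNIV" using r by simp
    then obtain d where "0 < d" "\<forall>p\<in>cball 0 r \<times> UNIV. dist p (0, t) < d \<longrightarrow> dist (\<psi> p) (\<psi> (0, t)) < \<eta>"
      using \<psi>_cont \<eta>(1) unfolding continuous_on_iff by metis
    then show ?thesis by (intro exI[of _ d]) (force simp: dist_real_def abs_less_iff)
  qed
  obtain d1 where d1: "0 < d1" "\<And>p. p \<in> cball 0 r \<times> UNIV \<Longrightarrow> dist p (0, b) < d1 \<Longrightarrow> \<psi> p \<le> a + \<eta>"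
    using near[of b] \<psi>_at by auto
  obtain d2 where d2: "0 < d2" "\<And>p. p \<in> cball 0 r \<times> UNIV \<Longrightarrow> dist p (0, - b) < d2 \<Longrightarrow> \<psi> p \<le> a + \<eta>"
    using near[of "- b"] \<psi>_at by auto
  define \<delta> where "\<delta> = min r (min d1 d2 / 4)"
  have \<delta>: "0 < \<delta>" "\<delta> \<le> r" "2 * \<delta> < d1" "2 * \<delta> < d2" using r d1 d2 by (auto simp: \<delta>_def)
  \<comment> \<open>Squared distance to the line spanned by \<open>e\<close>; \<open>S\<close> is
    thus a cylinder around the segment from \<open>- b\<close> to \<open>b\<close>, thickened in
    \<open>x\<close> as well.\<close>
  define w where "w t = (norm t)\<^sup>2 - (t \<bullet> e)\<^sup>2" for t
  have w: "w t = (norm (t - (t \<bullet> e) *\<^sub>R e))\<^sup>2" for t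
    by (simp add: w_def power2_norm_eq_inner inner_simps ee inner_commute) (simp add: power2_eq_square)
  have w_nonneg: "0 \<le> w t" for t by (simp add: w)
  define S where "S = {p :: (real^'n) \<times> (real^'m). norm (fst p) \<le> \<delta> \<and> \<bar>snd p \<bullet> e\<bar> \<le> \<beta> \<and> w (snd p) \<le> \<delta>\<^sup>2}"
  have S_sub: "S \<subseteq> cball 0 \<delta> \<times> cball 0 (\<beta> + \<delta>)"
  proof
    fix p :: "(real^'n) \<times> (real^'m)" assume p: "p \<in> S"
    have "(norm (snd p))\<^sup>2 = w (snd p) + (snd p \<bullet> e)\<^sup>2" by (simp add: w_def)
    also have "\<dots> \<le> \<delta>\<^sup>2 + \<beta>\<^sup>2" using p \<beta> by (intro add_mono) (auto simp: S_def abs_le_square_iff[symmetric])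
    also have "\<dots> \<le> (\<beta> + \<delta>)\<^sup>2" using \<beta> \<delta>(1) by (simp add: power2_sum)
    finally have "norm (snd p) \<le> \<beta> + \<delta>" using \<beta> \<delta>(1) by (auto intro: power2_le_imp_le)
    then show "p \<in> cball 0 \<delta> \<times> cball 0 (\<beta> + \<delta>)" using p by (cases p) (auto simp: S_def)
  qed
  have "closed S" unfolding S_def w_def by (intro closed_Collect_conj closed_Collect_le continuous_intros)
  moreover have "bounded S" by (rule bounded_subset[OF _ S_sub]) (intro bounded_Times bounded_cball)
  ultimately have S: "compact S" by (simp add: compact_eq_bounded_closed)
  have S_r: "S \<subseteq> cball 0 r \<times> UNIV" using S_sub \<delta>(2) by fastforce
  have S0: "(0, 0) \<in> S" using \<delta>(1) \<beta> by (simp add: S_def w_def)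
  obtain M0 where M0: "\<And>p. p \<in> S \<Longrightarrow> \<psi> p \<le> M0"
    using continuous_attains_sup[OF S _ continuous_on_subset[OF \<psi>_cont S_r]] S0 by (metis empty_iff)
  \<comment> \<open>On the lateral boundary of \<open>S\<close> the penalty reaches
    \<open>\<bar>M0\<bar> + \<bar>a\<bar>\<close>, enough to exclude a maximum there.\<close>
  define M where "M = (\<bar>M0\<bar> + \<bar>a\<bar>) / \<delta>\<^sup>2"
  have M: "0 \<le> M" "M * \<delta>\<^sup>2 = \<bar>M0\<bar> + \<bar>a\<bar>" using \<delta>(1) by (auto simp: M_def)
  \<comment> \<open>The convex term added along \<open>e\<close> costs at most \<eta> on
    \<open>S\<close>, and it makes the contact Hessian strictly negative in direction
    \<open>e\<close>.\<close>
  define c where "c = \<eta> / \<beta>\<^sup>2"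
  have c: "0 < c" "c * \<beta>\<^sup>2 = \<eta>" using \<eta> \<beta> by (auto simp: c_def)
  define \<Phi> where "\<Phi> p = \<psi> p + c * (snd p \<bullet> e)\<^sup>2 - M * w (snd p) - M * (norm (fst p))\<^sup>2" for p
  have "continuous_on S \<Phi>"
    unfolding \<Phi>_def w_def by (intro continuous_intros continuous_on_subset[OF \<psi>_cont S_r])
  then obtain p0 where p0: "p0 \<in> S" and max: "\<And>p. p \<in> S \<Longrightarrow> \<Phi> p \<le> \<Phi> p0"
    using continuous_attains_sup[OF S, of \<Phi>] S0 by blast
  obtain s0 t0 where st0: "p0 = (s0, t0)" by (cases p0)
  have "\<Phi> p0 = \<psi> p0 + c * (t0 \<bullet> e)\<^sup>2 - M * w t0 - M * (norm s0)\<^sup>2" by (simp add: \<Phi>_def st0)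
  moreover have "a + 4 * \<eta> \<le> \<Phi> p0" using max[OF S0] \<psi>_at(1) by (simp add: \<Phi>_def w_def)
  ultimately have big: "a + 4 * \<eta> \<le> \<psi> p0 + c * (t0 \<bullet> e)\<^sup>2 - M * w t0 - M * (norm s0)\<^sup>2" by linarith
  have cb: "c * (t0 \<bullet> e)\<^sup>2 \<le> \<eta>"
  proof -
    have "(t0 \<bullet> e)\<^sup>2 \<le> \<beta>\<^sup>2" using p0 \<beta> by (auto simp: S_def st0 abs_le_square_iff[symmetric])
    then have "c * (t0 \<bullet> e)\<^sup>2 \<le> c * \<beta>\<^sup>2" using c by (intro mult_left_mono) auto
    then show ?thesis using c by simp
  qed
  have pen: "0 \<le> M * w t0" "0 \<le> M * (norm s0)\<^sup>2" using M w_nonneg by simp_all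
  have "norm s0 < \<delta>"
  proof (rule ccontr)
    assume "\<not> norm s0 < \<delta>"
    then have "M * \<delta>\<^sup>2 \<le> M * (norm s0)\<^sup>2" using M \<delta>(1) by (intro mult_left_mono power_mono) auto
    then show False using big M0[OF p0] cb pen M(2) \<eta>(1) by linarith
  qed
  moreover have "w t0 < \<delta>\<^sup>2"
  proof (rule ccontr)
    assume "\<not> w t0 < \<delta>\<^sup>2"
    then have "M * \<delta>\<^sup>2 \<le> M * w t0" using M by (intro mult_left_mono) auto
    then show False using big M0[OF p0] cb pen M(2) \<eta>(1) by linarith
  qed
  \<comment> \<open>At an end of the cylinder \<open>p0\<close> lies within
    \<open>2 * \<delta>\<close> of \<open>(0, b)\<close> or \<open>(0, - b)\<close>, so its total is
    at most \<open>a + 2 * \<eta>\<close>, short of the value at the centre.\<close>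
  moreover have "\<bar>t0 \<bullet> e\<bar> < \<beta>"
  proof (rule ccontr)
    assume "\<not> \<bar>t0 \<bullet> e\<bar> < \<beta>"
    then have t0e: "t0 \<bullet> e = \<beta> \<or> t0 \<bullet> e = - \<beta>" using p0 by (auto simp: S_def st0)
    have t0w: "norm (t0 - (t0 \<bullet> e) *\<^sub>R e) \<le> \<delta>"
      by (rule power2_le_imp_le) (use p0 \<delta>(1) in \<open>auto simp: S_def st0 w\<close>)
    have s0: "norm s0 \<le> \<delta>" using p0 by (simp add: S_def st0)
    have dist: "dist p0 (0, t) \<le> norm s0 + norm (t0 - t)" for t
      using norm_Pair_le[of s0 "t0 - t"] by (simp add: dist_norm st0)
    have p0_r: "p0 \<in> cball 0 r \<times> UNIV" using S_r p0 by blast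
    have "\<psi> p0 \<le> a + \<eta>"
      using t0e
    proof
      assume "t0 \<bullet> e = \<beta>"
      then have "norm (t0 - b) \<le> \<delta>" using t0w by (simp add: b)
      then show ?thesis using d1(2)[OF p0_r] dist[of b] s0 \<delta>(3) by linarith
    next
      assume "t0 \<bullet> e = - \<beta>"
      then have "norm (t0 - (- b)) \<le> \<delta>" using t0w by (simp add: b)
      then show ?thesis using d2(2)[OF p0_r] dist[of "- b"] s0 \<delta>(4) by linarith
    qed
    then show False using big cb pen \<eta>(1) by linarith
  qed
  moreover define U where "U = {p :: (real^'n) \<times> (real^'m). norm (fst p) < \<delta> \<and> w (snd p) < \<delta>\<^sup>2 \<and> \<bar>snd p \<bullet> e\<bar> < \<beta>}"
  ultimately have "p0 \<in> U" by (simp add: st0)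
  moreover have "open U"
    unfolding U_def w_def by (intro open_Collect_conj open_Collect_less continuous_intros)
  ultimately obtain d where d: "0 < d" and "ball p0 d \<subseteq> U"
    using open_contains_ball by blast
  then have ballS: "ball p0 d \<subseteq> S" by (force simp: S_def U_def)
  define B where "B = (2 * M) *\<^sub>R (mat 1 :: real^'n^'n)"
  \<comment> \<open>Hessian of \<open>M * w t - c * (t \<bullet> e)\<^sup>2\<close>; its quadratic
    form at \<open>e\<close> is \<open>- 2 * c\<close>.\<close>
  define D where "D = (2 * M) *\<^sub>R (mat 1 :: real^'m^'m) - (2 * (M + c)) *\<^sub>R (\<chi> i j. e $ i * e $ j)"
  have D_mult: "D *v t = (2 * M) *\<^sub>R t - (2 * (M + c)) *\<^sub>R ((e \<bullet> t) *\<^sub>R e)" for t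
    by (simp add: D_def matrix_vector_mult_diff_rdistrib outer_product_mult_vec flip: scaleR_matrix_vector_assoc)
  have "upper_contact_prod f (x + s0) (y + t0) ((2 * M) *\<^sub>R s0) (l + (2 * M) *\<^sub>R t0 - (2 * (M + c) * (t0 \<bullet> e)) *\<^sub>R e) B 0 D"
  proof (rule upper_contact_prodI)
    show "0 < d / 2" using d by simp
    fix s :: "real^'n" and t :: "real^'m" assume st: "norm s < d / 2" "norm t < d / 2"
    have "dist p0 (s0 + s, t0 + t) \<le> norm s + norm t"
      using norm_Pair_le[of "- s" "- t"] by (simp add: st0 dist_norm)
    then have "(s0 + s, t0 + t) \<in> S" using ballS st by auto
    from max[OF this]
    have "f (x + s0 + s, y + t0 + t) \<le> f (x + s0, y + t0) + l \<bullet> t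
        - c * ((t0 + t) \<bullet> e)\<^sup>2 + c * (t0 \<bullet> e)\<^sup>2 + M * w (t0 + t) - M * w t0
        + M * (norm (s0 + s))\<^sup>2 - M * (norm s0)\<^sup>2"
      by (simp add: \<Phi>_def \<psi>_def st0 inner_add_right add.assoc)
    also have "\<dots> = f (x + s0, y + t0) + ((2 * M) *\<^sub>R s0) \<bullet> s
        + (l + (2 * M) *\<^sub>R t0 - (2 * (M + c) * (t0 \<bullet> e)) *\<^sub>R e) \<bullet> t
        + (1/2) * (s \<bullet> (B *v s) + 2 * (s \<bullet> (0 *v t)) + t \<bullet> (D *v t))"
      by (simp add: D_mult B_def w_def power2_norm_eq_inner inner_simps inner_commute) (simp add: power2_eq_square field_simps)
    finally show "f (x + s0 + s, y + t0 + t) \<le> f (x + s0, y + t0) + ((2 * M) *\<^sub>R s0) \<bullet> s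
        + (l + (2 * M) *\<^sub>R t0 - (2 * (M + c) * (t0 \<bullet> e)) *\<^sub>R e) \<bullet> t
        + (1/2) * (s \<bullet> (B *v s) + 2 * (s \<bullet> (0 *v t)) + t \<bullet> (D *v t))" .
  qed
  moreover have "sym_mat B" by (simp add: sym_mat_def B_def transpose_scalar)
  moreover have "sym_mat D"
    by (simp add: sym_mat_def D_def transpose_def vec_eq_iff mat_def mult.commute)
  moreover have "x + s0 \<in> X"
  proof -
    have "norm s0 \<le> r" using S_r p0 by (auto simp: st0)
    then have "x + s0 \<in> cball x r" by (simp add: dist_norm)
    then show ?thesis using r(2) by blast
  qed
  ultimately have "psd_mat D"
    using f unfolding sharp_P_subharmonic_def in_sharp_P_def by blast
  then have "0 \<le> e \<bullet> (D *v e)" by (simp add: psd_mat_def)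
  also have "e \<bullet> (D *v e) = - 2 * c" by (simp add: D_mult inner_simps ee)
  finally show False using c by simp
qed

section \<open>The minimum principle\<close>

text \<open>A nearly optimal \<open>y\<close> at \<open>x\<close> remains a competitor at nearby
  points, with a nearby value. The bound \<open>c\<close> makes the real-valued \<open>INF\<close> a
  genuine infimum.\<close>

lemma usc_on_INF:
  fixes f :: "'a::metric_space \<times> 'b::topological_space \<Rightarrow> real"
  assumes cont: "continuous_on (X \<times> UNIV) f" and bdd: "\<And>x y. x \<in> X \<Longrightarrow> c \<le> f (x, y)"
  shows "usc_on X (\<lambda>x. INF y. f (x, y))"
  unfolding usc_on_def
proof (intro ballI allI impI)
  fix x and e :: real assume x: "x \<in> X" and e: "0 < e"
  then have "(INF y. f (x, y)) < (INF y. f (x, y)) + e" by simp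
  then obtain y where y: "f (x, y) < (INF y. f (x, y)) + e"
    using bdd[OF x] by (subst (asm) cINF_less_iff) (auto intro: bdd_belowI2[of _ c])
  have "continuous_on X (\<lambda>x. f (x, y))"
    by (intro continuous_on_compose2[OF cont] continuous_intros) auto
  then have "((\<lambda>x. f (x, y)) \<longlongrightarrow> f (x, y)) (at x within X)"
    using x by (simp add: continuous_on_def)
  from order_tendstoD(2)[OF this y] have "\<forall>\<^sub>F x' in at x within X. f (x', y) < (INF y. f (x, y)) + e" .
  moreover have "\<forall>\<^sub>F x' in at x within X. x' \<in> X"
    by (simp add: eventually_at_filter)
  ultimately show "\<forall>\<^sub>F x' in at x within X. (INF y. f (x', y)) < (INF y. f (x, y)) + e"
  proof eventually_elim
    case (elim x')
    have "(INF y. f (x', y)) \<le> f (x', y)"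
      using bdd[OF elim(2)] by (intro cINF_lower) (auto intro: bdd_belowI2[of _ c])
    with elim show ?case by simp
  qed
qed

text \<open>The complement of the fibre is relatively open, which leaves room to enlarge the
  Hessian; this \<epsilon> later makes the contact strict.\<close>

lemma notin_subequation_perturb:
  fixes A :: "real^'n^'n"
  assumes "closedin (top_of_set (J2 X)) F" and "(x, r, p, A) \<notin> F" "x \<in> X" "sym_mat A"
  obtains \<epsilon> where "0 < \<epsilon>" "(x, r, p, A + \<epsilon> *\<^sub>R mat 1) \<notin> F"
proof -
  obtain T where T: "closed T" "F = J2 X \<inter> T" using assms(1) by (auto simp: closedin_closed)
  have "(x, r, p, A) \<notin> T" using assms(2-4) T(2) by (auto simp: J2_def)
  moreover have "((\<lambda>\<epsilon>. (x, r, p, A + \<epsilon> *\<^sub>R mat 1)) \<longlongrightarrow> (x, r, p, A + 0 *\<^sub>R mat 1)) (at_right (0::real))"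
    by (intro tendsto_intros)
  ultimately have "\<forall>\<^sub>F \<epsilon> in at_right 0. (x, r, p, A + \<epsilon> *\<^sub>R mat 1) \<in> - T"
    using T(1) by (intro topological_tendstoD) auto
  moreover have "\<forall>\<^sub>F \<epsilon> in at_right 0. (0::real) < \<epsilon>" by (simp add: eventually_at_right_less)
  ultimately have "\<forall>\<^sub>F \<epsilon> in at_right 0. 0 < \<epsilon> \<and> (x, r, p, A + \<epsilon> *\<^sub>R mat 1) \<notin> F"
    by eventually_elim (auto simp: T(2))
  then show thesis using that eventually_happens' trivial_limit_at_right_real by blast
qed

theorem theorem1p2:
  fixes X :: "(real^'n) set"
    and F :: "((real^'n) \<times> real \<times> (real^'n) \<times> (real^'n^'n)) set"
    and f :: "(real^'n) \<times> (real^'m) \<Rightarrow> real"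
  assumes "open X"
    and "primitive_subequation X F"
    and "constant_coefficient X F"
    and "hessian_only X F"
    and "locally_semiconcave_on (X \<times> UNIV) f"
    and "\<exists>c. \<forall>x\<in>X. \<forall>y. c \<le> f (x, y)"
    and "sharp_P_subharmonic X F f"
  shows "F_subharmonic X F (\<lambda>x. INF y. f (x, y))"
proof -
  define g where "g x = (INF y. f (x, y))" for x
  have cont: "continuous_on (X \<times> UNIV) f"
    using assms(5) by (rule locally_semiconcave_imp_continuous_on)
  obtain c where c: "\<And>x y. x \<in> X \<Longrightarrow> c \<le> f (x, y)" using assms(6) by blast
  have g_le: "g x \<le> f (x, y)" if "x \<in> X" for x y
    unfolding g_def using c[OF that] by (intro cINF_lower) (auto intro: bdd_belowI2[of _ c])
  have g_less: "\<exists>y. f (x, y) < k" if "x \<in> X" "g x < k" for x k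
    using that c[of x] unfolding g_def by (subst (asm) cINF_less_iff) (auto intro: bdd_belowI2[of _ c])
  have "usc_on X g" unfolding g_def using cont c by (rule usc_on_INF)
  moreover have "(x0, g x0, p, A) \<in> F"
    if x0: "x0 \<in> X" and A: "sym_mat A" and contact: "upper_contact g x0 p A" for x0 p A
  proof (rule ccontr)
    assume "(x0, g x0, p, A) \<notin> F"
    then obtain \<epsilon> where \<epsilon>: "0 < \<epsilon>" and notin: "(x0, g x0, p, A + \<epsilon> *\<^sub>R mat 1) \<notin> F"
      using notin_subequation_perturb assms(2) x0 A unfolding primitive_subequation_def by metis
    define A' where "A' = A + \<epsilon> *\<^sub>R mat 1"
    have A'_sym: "sym_mat A'" using A by (simp add: sym_mat_def A'_def transpose_plus transpose_scalar)
    have A'_mult: "A' *v s = A *v s + \<epsilon> *\<^sub>R s" for s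
      by (simp add: A'_def matrix_vector_mult_add_rdistrib)
    have A'_swap: "s \<bullet> (A' *v t) = t \<bullet> (A' *v s)" for s t
      using A'_sym by (metis dot_lmul_matrix inner_commute sym_mat_def transpose_matrix_vector)
    \<comment> \<open>The test quadratic in coordinates centred at \<open>x0\<close>, with the
      Hessian already enlarged.\<close>
    define q where "q s = p \<bullet> s + (1/2) * (s \<bullet> (A' *v s))" for s
    have q_add: "q (a + s) = q a + (p + A' *v a) \<bullet> s + (1/2) * (s \<bullet> (A' *v s))" for a s
      using A'_swap[of a s] A'_swap[of s a]
      by (simp add: q_def matrix_vector_right_distrib inner_simps inner_commute algebra_simps)
    obtain d where d: "0 < d"
      and g_contact: "\<And>y. y \<in> ball x0 d \<Longrightarrow> g y \<le> g x0 + p \<bullet> (y - x0) + (1/2) * ((y - x0) \<bullet> (A *v (y - x0)))"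
      using contact unfolding upper_contact_def by blast
    obtain \<rho>0 where \<rho>0: "0 < \<rho>0" "cball x0 \<rho>0 \<subseteq> X" using assms(1) x0 open_contains_cball by metis
    define \<rho> where "\<rho> = min \<rho>0 (d / 2)"
    have \<rho>: "0 < \<rho>" "\<rho> \<le> \<rho>0" "\<rho> < d" using \<rho>0 d by (auto simp: \<rho>_def)
    have inX: "x0 + s \<in> X" if "s \<in> cball 0 \<rho>" for s
      using that \<rho> \<rho>0(2) by (auto simp: subset_iff dist_norm)
    define u where "u z = f (x0 + fst z, snd z) - q (fst z)" for z
    \<comment> \<open>On the sphere of radius \<open>\<rho> / 2\<close> the enlarged quadratic
      exceeds the original one by exactly \<open>2 * \<mu>\<close>; one \<mu> is kept as slack for
      choosing a nearly optimal \<open>y\<close>.\<close>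
    define \<mu> where "\<mu> = \<epsilon> / 4 * (\<rho> / 2)\<^sup>2"
    have \<mu>: "0 < \<mu>" using \<epsilon> \<rho> by (simp add: \<mu>_def)
    have q_cont: "continuous_on S q" for S
      unfolding q_def by (intro continuous_intros matrix_vector_mult_linear_continuous_on)
    have "cball (0::real^'n) \<rho> \<noteq> {}" using \<rho>(1) by simp
    then obtain Q where Q: "\<And>s. s \<in> cball 0 \<rho> \<Longrightarrow> q s \<le> Q"
      using continuous_attains_sup[OF compact_cball _ q_cont] by metis
    obtain x y p1 p2 \<Gamma> K r where x: "x \<in> ball 0 \<rho>" and \<Gamma>: "linear \<Gamma>" and r: "0 < r"
      and u_contact: "\<And>s t. \<lbrakk>norm s < r; norm t < r\<rbrakk> \<Longrightarrow>
        u (x + s, y + t) \<le> u (x, y) + p1 \<bullet> s + p2 \<bullet> t + K * (norm (t - \<Gamma> s))\<^sup>2"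
    proof (rule marginal_peak_contact[OF \<rho>(1), where u = u])
      show "continuous_on (cball 0 \<rho> \<times> UNIV) u"
        unfolding u_def
      proof (intro continuous_intros continuous_on_compose2[OF cont] continuous_on_compose2[OF q_cont[of UNIV]])
        show "(\<lambda>z. (x0 + fst z, snd z)) ` (cball 0 \<rho> \<times> UNIV) \<subseteq> X \<times> UNIV" using inX by auto
      qed auto
      show "2 * u (x, y) \<le> u (x, y + b) + u (x, y - b)" if "x \<in> cball 0 \<rho>" for x y b
        using sharp_P_subharmonic_slice_convex[OF assms(1,7) cont inX[OF that]] by (simp add: u_def)
      show "\<exists>\<kappa>\<ge>0. \<forall>x y a b. x + a \<in> cball 0 \<rho> \<longrightarrow> x - a \<in> cball 0 \<rho> \<longrightarrow>
          y + b \<in> cball 0 R \<longrightarrow> y - b \<in> cball 0 R \<longrightarrow>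
          u (x + a, y + b) + u (x - a, y - b) \<le> 2 * u (x, y) + \<kappa> * ((norm a)\<^sup>2 + (norm b)\<^sup>2)" for R
      proof -
        have "cball x0 \<rho> \<times> cball (0::real^'m) R \<subseteq> X \<times> UNIV" using \<rho>(2) \<rho>0(2) by fastforce
        then obtain \<kappa> where \<kappa>: "0 \<le> \<kappa>" and f_semi: "\<And>z v. \<lbrakk>z + v \<in> cball x0 \<rho> \<times> cball 0 R; z - v \<in> cball x0 \<rho> \<times> cball 0 R\<rbrakk>
            \<Longrightarrow> f (z + v) + f (z - v) \<le> 2 * f z + \<kappa> * (norm v)\<^sup>2"
          using locally_semiconcave_imp_midpoint_on_compact[OF assms(5), of "cball x0 \<rho> \<times> cball 0 R"]
          by (metis compact_Times compact_cball convex_Times convex_cball)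
        \<comment> \<open>Subtracting \<open>q\<close> spoils the semiconcavity constant of
          \<open>f\<close> by at most a bound for the operator \<open>A'\<close>.\<close>
        obtain N where N: "0 < N" "\<And>s. norm (A' *v s) \<le> N * norm s"
          using linear_bounded_pos[OF matrix_vector_mul_linear[of A']] by (metis mult.commute)
        have "u (x + a, y + b) + u (x - a, y - b) \<le> 2 * u (x, y) + (\<kappa> + N) * ((norm a)\<^sup>2 + (norm b)\<^sup>2)"
          if "x + a \<in> cball 0 \<rho>" "x - a \<in> cball 0 \<rho>" "y + b \<in> cball 0 R" "y - b \<in> cball 0 R" for x y a b
        proof -
          have "f ((x0 + x, y) + (a, b)) + f ((x0 + x, y) - (a, b)) \<le> 2 * f (x0 + x, y) + \<kappa> * (norm (a, b))\<^sup>2"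
            using that by (intro f_semi) (auto simp: dist_norm algebra_simps norm_minus_commute)
          moreover have "(norm (a, b))\<^sup>2 = (norm a)\<^sup>2 + (norm b)\<^sup>2" by (simp add: norm_Pair)
          moreover have "q (x + a) + q (x - a) = 2 * q x + a \<bullet> (A' *v a)"
            using q_add[of x a] q_add[of x "- a"] by (simp add: vec.neg inner_simps)
          moreover have "- (a \<bullet> (A' *v a)) \<le> N * (norm a)\<^sup>2"
          proof -
            have "- (a \<bullet> (A' *v a)) \<le> norm a * norm (A' *v a)"
              using norm_cauchy_schwarz[of "- a" "A' *v a"] by simp
            also have "\<dots> \<le> norm a * (N * norm a)" using N(2) by (intro mult_left_mono) auto
            finally show ?thesis by (simp add: power2_eq_square mult_ac)
          qed
          moreover have "0 \<le> N * (norm b)\<^sup>2" using N by simp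
          ultimately show ?thesis by (simp add: u_def algebra_simps)
        qed
        then show ?thesis using \<kappa> N(1) by (intro exI[of _ "\<kappa> + N"]) auto
      qed
      show "c - Q \<le> u (x, y)" if "x \<in> cball 0 \<rho>" for x y
        using c[OF inX[OF that], of y] Q[OF that] by (simp add: u_def)
      show "g x0 \<le> u (0, y)" for y using g_le[OF x0, of y] by (simp add: u_def q_def)
      show "\<exists>y. u (s, y) < g x0 - \<mu>" if s: "norm s = \<rho> / 2" for s
      proof -
        have s_in: "s \<in> cball 0 \<rho>" "x0 + s \<in> ball x0 d" using s \<rho> by (auto simp: dist_norm)
        have "q s = p \<bullet> s + (1/2) * (s \<bullet> (A *v s)) + 2 * \<mu>"
          unfolding \<mu>_def s[symmetric] by (simp add: q_def A'_mult inner_add_right power2_norm_eq_inner)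
        then have "g (x0 + s) < g x0 - \<mu> + q s" using g_contact[OF s_in(2)] \<mu> by simp
        from g_less[OF inX[OF s_in(1)] this] show ?thesis by (auto simp: u_def algebra_simps)
      qed
    qed (rule \<mu>, blast)
    have "x0 + x \<in> X" using inX x by simp
    have "\<exists>p'. (x0 + x, f (x0 + x, y), p', A') \<in> F"
    proof (rule sharp_P_subharmonic_marginal_contact[OF assms(7) \<open>x0 + x \<in> X\<close> A'_sym \<Gamma> r])
      fix s :: "real^'n" and t :: "real^'m" assume "norm s < r" "norm t < r"
      from u_contact[OF this] q_add[of x s]
      show "f (x0 + x + s, y + t) \<le> f (x0 + x, y) + (p1 + (p + A' *v x)) \<bullet> s + p2 \<bullet> t
          + (1/2) * (s \<bullet> (A' *v s)) + K * (norm (t - \<Gamma> s))\<^sup>2"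
        by (simp add: u_def inner_add_left add.assoc)
    qed
    \<comment> \<open>The contact was found at another base point, with another value and gradient;
      constant coefficients and dependence on the Hessian alone carry \<open>A'\<close> back to the
      jet at \<open>x0\<close>.\<close>
    then have "(x0, g x0, p, A') \<in> F"
      using assms(3,4) x0 \<open>x0 + x \<in> X\<close> unfolding constant_coefficient_def hessian_only_def by metis
    with notin show False by (simp add: A'_def)
  qed
  ultimately show ?thesis unfolding F_subharmonic_def g_def by blast
qed

end
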